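(* Let $(N,B,L)$ be a Hadamard triple in $\mathbb{R}$ with $\#B<N$. Write $$\mathcal{E}_N:=\Big\{\frac{v}{u}:\ u,v\in\mathbb{N},\ \gcd(u,v)=1,\ \gcd(uv,N)=1\Big\}.$$ Then every rational number $t\in\mathcal{E}_N$ is a spectral eigenvalue of $\mu_{N,B}$. Moreover, for any $k\in\mathbb{N}$ and any $t_1,t_2,\ldots,t_k\in\mathcal{E}_N$, the collection $$\big\{\Lambda\subset\mathbb{R}:\ 0\in\Lambda\ \text{ and }\ \Lambda,\,t_1\Lambda,\,t_2\Lambda,\ldots,t_k\Lambda\ \text{ are all spectra of }\mu_{N,B}\big\}$$ is infinite.
   Context: $\mathbb{N}=\{1,2,3,\ldots\}$ and $\#$ denotes cardinality. Hadamard triple: let $N\ge 2$ be an integer and let $B,L\subset\mathbb{Z}$ be finite sets with $\#B=\#L\ge 2$; $(N,B,L)$ is a Hadamard triple in $\mathbb{R}$ if the matrix $M=\Big(\frac{1}{\sqrt{\#B}}e^{2\pi\mathrm{i}\frac{b\ell}{N}}\Big)_{b\in B,\ \ell\in L}$ is unitary, i.e. $M^*M=I$. The self-similar measure $\mu_{N,B}$ is the unique Borel probability measure $\mu$ on $\mathbb{R}$ satisfying $\mu=\frac{1}{\#B}\sum_{b\in B}\mu\circ\tau_b^{-1}$, where $\tau_b(x)=(x+b)/N$. Spectrum: for a Borel probability measure $\mu$ on $\mathbb{R}$, a set $\Lambda\subset\mathbb{R}$ is a spectrum of $\mu$ if $\{e^{2\pi\mathrm{i}\lambda x}:\lambda\in\Lambda\}$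 forms an orthonormal basis of $L^2(\mu)$. A real number $t$ is a spectral eigenvalue of $\mu$ if there exists $\Lambda\subset\mathbb{R}$ such that both $\Lambda$ and $t\Lambda=\{t\lambda:\lambda\in\Lambda\}$ are spectra of $\mu$. *)

theory Defs
  imports "HOL-Probability.Probability"
begin

definition hadamard_entry :: "nat \<Rightarrow> int set \<Rightarrow> int \<Rightarrow> int \<Rightarrow> complex" where
  "hadamard_entry N B b l =
     exp (2 * of_real pi * \<i> * (of_int b * of_int l / of_nat N)) / of_real (sqrt (real (card B)))"

text \<open>The last conjunct is the identity \<open>M\<^sup>* M = I\<close> read entrywise: the matrix is indexed by
  the finite sets \<open>B\<close> (rows) and \<open>L\<close> (columns).\<close>
definition hadamard_triple :: "nat \<Rightarrow> int set \<Rightarrow> int set \<Rightarrow> bool" where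
  "hadamard_triple N B L \<longleftrightarrow>
     N \<ge> 2 \<and> finite B \<and> finite L \<and> card B = card L \<and> card B \<ge> 2 \<and>
     (\<forall>l\<in>L. \<forall>l'\<in>L.
        (\<Sum>b\<in>B. cnj (hadamard_entry N B b l) * hadamard_entry N B b l')
          = (if l = l' then 1 else 0))"

definition ifs_map :: "nat \<Rightarrow> int \<Rightarrow> real \<Rightarrow> real" where
  "ifs_map N b x = (x + of_int b) / of_nat N"

definition is_self_similar_measure :: "nat \<Rightarrow> int set \<Rightarrow> real measure \<Rightarrow> bool" where
  "is_self_similar_measure N B \<mu> \<longleftrightarrow>
     prob_space \<mu> \<and> sets \<mu> = sets borel \<and>
     (\<forall>A\<in>sets borel. measure \<mu> A =
        (1 / real (card B)) * (\<Sum>b\<in>B. measure (distr \<mu> borel (ifs_map N b)) A))"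

text \<open>For \<open>N \<ge> 2\<close> and \<open>B\<close> finite and nonempty, Hutchinson's theorem provides existence and
  uniqueness, so the description is proper.\<close>
definition self_similar_measure :: "nat \<Rightarrow> int set \<Rightarrow> real measure" where
  "self_similar_measure N B = (THE \<mu>. is_self_similar_measure N B \<mu>)"

text \<open>Functions represent their classes in \<open>L\<^sup>2(M)\<close>; no quotient by almost everywhere equality
  is formed, since inner products and norms depend only on the classes.\<close>
definition L2_functions :: "'a measure \<Rightarrow> ('a \<Rightarrow> complex) set" where
  "L2_functions M = {f \<in> borel_measurable M. integrable M (\<lambda>x. (norm (f x))\<^sup>2)}"

definition L2_inner :: "'a measure \<Rightarrow> ('a \<Rightarrow> complex) \<Rightarrow> ('a \<Rightarrow> complex) \<Rightarrow> complex" where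
  "L2_inner M f g = (LINT x|M. f x * cnj (g x))"

definition L2_norm :: "'a measure \<Rightarrow> ('a \<Rightarrow> complex) \<Rightarrow> real" where
  "L2_norm M f = sqrt (LINT x|M. (norm (f x))\<^sup>2)"

text \<open>A family of square integrable functions is an orthonormal basis if it is orthonormal and its
  finite linear combinations are dense.\<close>
definition L2_orthonormal_basis :: "'a measure \<Rightarrow> 'i set \<Rightarrow> ('i \<Rightarrow> 'a \<Rightarrow> complex) \<Rightarrow> bool" where
  "L2_orthonormal_basis M I e \<longleftrightarrow>
     (\<forall>i\<in>I. e i \<in> L2_functions M) \<and>
     (\<forall>i\<in>I. \<forall>j\<in>I. L2_inner M (e i) (e j) = (if i = j then 1 else 0)) \<and>
     (\<forall>f\<in>L2_functions M. \<forall>\<epsilon>>0. \<exists>F c. finite F \<and> F \<subseteq> I \<and>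
        L2_norm M (\<lambda>x. f x - (\<Sum>i\<in>F. c i * e i x)) < \<epsilon>)"

definition is_spectrum :: "real measure \<Rightarrow> real set \<Rightarrow> bool" where
  "is_spectrum \<mu> \<Lambda> \<longleftrightarrow>
     L2_orthonormal_basis \<mu> \<Lambda> (\<lambda>l x. exp (2 * of_real pi * \<i> * of_real (l * x)))"

definition spectral_eigenvalue :: "real measure \<Rightarrow> real \<Rightarrow> bool" where
  "spectral_eigenvalue \<mu> t \<longleftrightarrow>
     (\<exists>\<Lambda>. is_spectrum \<mu> \<Lambda> \<and> is_spectrum \<mu> ((\<lambda>l. t * l) ` \<Lambda>))"

definition eigen_ratios :: "nat \<Rightarrow> real set" where
  "eigen_ratios N =
     {real v / real u | u v :: nat. u \<ge> 1 \<and> v \<ge> 1 \<and> gcd u v = 1 \<and> gcd (u * v) N = 1}"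

end

theory Submission
  imports Defs
begin

text \<open>Write \<open>\<mu>\<close> for the self-similar measure and \<open>\<mu>^\<close> for its Fourier transform. With the mask
  \<open>m(x) = (1/#B) \<Sum>b\<in>B. e(bx)\<close>, where \<open>e(x) = exp(2\<pi>ix)\<close>, self-similarity reads \<open>\<mu>^(x) = m(x/N) \<mu>^(x/N)\<close>,
  hence \<open>\<mu>^(x) = M\<^sub>n(x) \<mu>^(x/N\<^sup>n)\<close> with \<open>M\<^sub>n(x) = m(x/N) \<cdot> \<dots> \<cdot> m(x/N\<^sup>n)\<close>.

  A single set \<open>\<Lambda>\<close> of integers is constructed such that \<open>p\<Lambda>\<close> is a spectrum for \<^emph>\<open>every\<close> positive
  integer \<open>p\<close> coprime to \<open>N\<close> (\<open>universal_spectrum\<close>). This gives the theorem: if \<open>t\<^sub>i = v\<^sub>i/u\<^sub>i\<close> and \<open>U\<close> is the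
  product of the \<open>u\<^sub>i\<close>, then each of the sets \<open>U(N+1)\<^sup>j\<Lambda>\<close>, together with its dilates by the \<open>t\<^sub>i\<close>, has
  the form \<open>p\<Lambda>\<close>, and these sets are pairwise different because the least nonzero absolute value
  grows with \<open>j\<close>.

  Four facts enter the construction.

  \<^item> If \<open>p\<close> is coprime to \<open>N\<close>, then \<open>(N, B, pL)\<close> is again a Hadamard triple: a vanishing sum of
    \<open>N\<close>-th roots of unity still vanishes when every root is raised to the \<open>p\<close>-th power
    (\<open>vanishing_sum_galois\<close>). Consequently \<open>\<Sum>l\<in>L. |m(x + pl/N)|\<^sup>2 = 1\<close> for all \<open>x\<close> (\<open>mask_frame_L\<close>).

  \<^item> For every \<open>x\<close> some integer translate satisfies \<open>\<mu>^(p(x+k)) \<noteq> 0\<close> (\<open>translate_nonvanishing\<close>). The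
    points without such a translate form a set that is finite modulo 1, and the inequality
    \<open>#B < N\<close> forces each of them to have two preimages under \<open>x \<mapsto> Nx\<close> in that same set. By compactness
    the lower bound is uniform (\<open>uniform_lower_bound\<close>).

  \<^item> A set \<open>\<Lambda>\<close> of representatives of \<open>L + NL + \<dots> + N\<^bsup>n-1\<^esup>L\<close> modulo \<open>N\<^sup>n\<close> satisfies
    \<open>\<Sum>l\<in>\<Lambda>. |M\<^sub>n(x + pl)|\<^sup>2 = 1\<close> whatever representatives are chosen. The set \<open>\<Lambda>\<close> is built as an
    increasing union of such finite sets \<open>\<Lambda>\<^sub>k\<close> of level \<open>n\<^sub>k\<close>. At stage \<open>k\<close> one multiplier \<open>p\<close> is served: the
    representatives are chosen such that \<open>|\<mu>^(pl/N\<^sup>n)|\<close>, with \<open>n = n\<^sub>k\<close>, is bounded below on \<open>\<Lambda>\<^sub>k\<close>. Every multiplier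
    is served infinitely often, and that suffices to pass to the limit and to obtain
    \<open>\<Sum>l\<in>\<Lambda>. |\<mu>^(x + pl)|\<^sup>2 = 1\<close> for all real \<open>x\<close> (\<open>parseval_union\<close>).

  \<^item> That identity makes \<open>p\<Lambda>\<close> a spectrum (\<open>spectrum_if_parseval\<close>): it is Parseval's identity for all
    exponential functions, and these span a dense subspace of \<open>L\<^sup>2(\<mu>)\<close>.\<close>

section \<open>Vanishing sums of roots of unity\<close>

definition e2pi :: "real \<Rightarrow> complex" where
  "e2pi x = cis (2 * pi * x)"

lemma e2pi_add: "e2pi (x + y) = e2pi x * e2pi y"
  by (simp add: e2pi_def cis_mult distrib_left)

lemma e2pi_of_int [simp]: "e2pi (of_int k) = 1"
  using cis_multiple_2pi[of "of_int k"] by (simp add: e2pi_def)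

lemma e2pi_0 [simp]: "e2pi 0 = 1"
  by (simp add: e2pi_def)

lemma norm_e2pi [simp]: "norm (e2pi x) = 1"
  by (simp add: e2pi_def)

lemma e2pi_nonzero [simp]: "e2pi x \<noteq> 0"
  by (simp add: e2pi_def)

lemma cnj_e2pi: "cnj (e2pi x) = e2pi (- x)"
  by (simp add: e2pi_def cis_cnj)

lemma e2pi_mult_cnj: "e2pi x * cnj (e2pi y) = e2pi (x - y)"
  by (simp add: cnj_e2pi flip: e2pi_add)

lemma e2pi_power: "e2pi x ^ k = e2pi (real k * x)"
  by (simp add: e2pi_def Complex.DeMoivre mult.left_commute)

lemma e2pi_diff_int: "x - y \<in> \<int> \<Longrightarrow> e2pi x = e2pi y"
proof -
  assume "x - y \<in> \<int>"
  then obtain k where "x = y + of_int k"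
    by (metis Ints_cases add_diff_cancel_left' diff_add_cancel add.commute)
  then show ?thesis by (simp add: e2pi_add)
qed

lemma e2pi_eq_1D: "e2pi x = 1 \<Longrightarrow> \<exists>k::int. x = of_int k"
proof -
  assume "e2pi x = 1"
  then have "cos (2 * pi * x) = 1" by (simp add: e2pi_def complex_eq_iff)
  then obtain k :: int where "2 * pi * x = of_int k * 2 * pi" unfolding cos_one_2pi_int by auto
  then have "x = of_int k" using pi_neq_zero by (simp add: field_simps)
  then show ?thesis ..
qed

lemma e2pi_mod: 
  assumes "N > 0"
  shows "e2pi (of_int (j mod int N) / real N) = e2pi (of_int j / real N)"
proof (rule e2pi_diff_int)
  have "of_int (j mod int N) = (of_int j - real N * of_int (j div int N) :: real)"
    by (metis minus_mult_div_eq_mod of_int_diff of_int_mult of_int_of_nat_eq)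
  then have "of_int (j mod int N) / real N - of_int j / real N = - of_int (j div int N)"
    using assms by (simp add: field_simps)
  then show "of_int (j mod int N) / real N - of_int j / real N \<in> \<int>" by simp
qed

text \<open>The ring \<open>\<int>[\<zeta>]\<close> for \<open>\<zeta> = e(1/N)\<close>, generated additively by the powers of \<open>\<zeta>\<close>. In this form, additive
  maps on the ring are controlled by their finitely many values on the powers of \<open>\<zeta>\<close>.\<close>
inductive_set cyclotomic_ring :: "nat \<Rightarrow> complex set" for N :: nat where
  zero: "0 \<in> cyclotomic_ring N"
| plus: "x \<in> cyclotomic_ring N \<Longrightarrow> x + e2pi (of_int j / real N) \<in> cyclotomic_ring N"
| minus: "x \<in> cyclotomic_ring N \<Longrightarrow> x - e2pi (of_int j / real N) \<in> cyclotomic_ring N"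

lemma cyclotomic_ring_root: "e2pi (of_int j / real N) \<in> cyclotomic_ring N"
  using cyclotomic_ring.plus[OF cyclotomic_ring.zero] by simp

lemma cyclotomic_ring_add:
  assumes "x \<in> cyclotomic_ring N" "y \<in> cyclotomic_ring N"
  shows "x + y \<in> cyclotomic_ring N"
  using assms(2)
proof induction
  case (plus y j) then show ?case using cyclotomic_ring.plus[of "x + y" N j] by (simp add: add_ac)
next
  case (minus y j) then show ?case using cyclotomic_ring.minus[of "x + y" N j] by (simp add: algebra_simps)
qed (use assms in simp)

lemma cyclotomic_ring_uminus:
  assumes "x \<in> cyclotomic_ring N" shows "- x \<in> cyclotomic_ring N"
  using assms
proof induction
  case (plus y j) then show ?case using cyclotomic_ring.minus[of "- y" N j] by simp
next
  case (minus y j) then show ?case using cyclotomic_ring.plus[of "- y" N j] by (simp add: algebra_simps)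
qed (simp add: cyclotomic_ring.zero)

lemma cyclotomic_ring_sum:
  "(\<And>i. i \<in> I \<Longrightarrow> f i \<in> cyclotomic_ring N) \<Longrightarrow> sum f I \<in> cyclotomic_ring N"
  by (induction I rule: infinite_finite_induct)
     (auto simp: cyclotomic_ring.zero intro: cyclotomic_ring_add)

lemma cyclotomic_ring_mult:
  assumes "x \<in> cyclotomic_ring N" "y \<in> cyclotomic_ring N"
  shows "x * y \<in> cyclotomic_ring N"
proof -
  have root: "x * e2pi (of_int j / real N) \<in> cyclotomic_ring N" for j
    using assms(1)
  proof induction
    case (plus x i)
    have "(x + e2pi (of_int i / real N)) * e2pi (of_int j / real N) =
          x * e2pi (of_int j / real N) + e2pi (of_int (i + j) / real N)"
      by (simp add: distrib_right add_divide_distrib e2pi_add)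
    then show ?case using cyclotomic_ring.plus[OF plus.IH] by metis
  next
    case (minus x i)
    have "(x - e2pi (of_int i / real N)) * e2pi (of_int j / real N) =
          x * e2pi (of_int j / real N) - e2pi (of_int (i + j) / real N)"
      by (simp add: left_diff_distrib add_divide_distrib e2pi_add)
    then show ?case using cyclotomic_ring.minus[OF minus.IH] by metis
  qed (simp add: cyclotomic_ring.zero)
  from assms(2) show ?thesis
  proof induction
    case (plus y j) then show ?case using cyclotomic_ring_add[OF plus.IH root] by (simp add: distrib_left)
  next
    case (minus y j) then show ?case
      using cyclotomic_ring_add[OF minus.IH cyclotomic_ring_uminus[OF root]] by (simp add: right_diff_distrib)
  qed (simp add: cyclotomic_ring.zero)
qed

lemma cyclotomic_ring_power: "x \<in> cyclotomic_ring N \<Longrightarrow> x ^ k \<in> cyclotomic_ring N"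
proof (induction k)
  case 0 then show ?case using cyclotomic_ring_root[of 0 N] by simp
qed (simp add: cyclotomic_ring_mult)

lemma cyclotomic_ring_of_nat_mult: "x \<in> cyclotomic_ring N \<Longrightarrow> of_nat k * x \<in> cyclotomic_ring N"
  by (induction k) (auto simp: cyclotomic_ring.zero distrib_right intro: cyclotomic_ring_add)

lemma prime_power_add_mod:
  assumes p: "prime p" and "x \<in> cyclotomic_ring N" "y \<in> cyclotomic_ring N"
  shows "\<exists>z\<in>cyclotomic_ring N. (x + y) ^ p = x ^ p + y ^ p + of_nat p * z"
proof -
  define z where "z = (\<Sum>k\<in>{1..<p}. of_nat ((p choose k) div p) * (x ^ k * y ^ (p - k)))"
  have "z \<in> cyclotomic_ring N"
    unfolding z_def using assms
    by (intro cyclotomic_ring_sum cyclotomic_ring_of_nat_mult cyclotomic_ring_mult cyclotomic_ring_power)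
  have p1: "p > 1" using p prime_gt_1_nat by blast
  have dvd: "of_nat p * of_nat ((p choose k) div p) = (of_nat (p choose k) :: complex)" if "k \<in> {1..<p}" for k
  proof -
    have "p dvd (p choose k)" using dvd_choose_prime[of k p] that p by simp
    then show ?thesis by (metis dvd_mult_div_cancel of_nat_mult)
  qed
  have "{..p} = insert 0 (insert p {1..<p})" using p1 by auto
  then have "(x + y) ^ p = y ^ p + (x ^ p + (\<Sum>k\<in>{1..<p}. of_nat (p choose k) * x ^ k * y ^ (p - k)))"
    using p1 unfolding binomial_ring by simp
  also have "(\<Sum>k\<in>{1..<p}. of_nat (p choose k) * x ^ k * y ^ (p - k)) = of_nat p * z"
    unfolding z_def sum_distrib_left by (intro sum.cong refl) (simp add: mult.assoc[symmetric] dvd)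
  finally show ?thesis using \<open>z \<in> _\<close> by (intro bexI[of _ z]) (simp_all add: add_ac)
qed

lemma prime_power_sum_mod:
  assumes p: "prime p" and "\<And>i. i \<in> I \<Longrightarrow> f i \<in> cyclotomic_ring N"
  shows "\<exists>z\<in>cyclotomic_ring N. (\<Sum>i\<in>I. f i) ^ p = (\<Sum>i\<in>I. f i ^ p) + of_nat p * z"
  using assms(2)
proof (induction I rule: infinite_finite_induct)
  case (insert i I)
  obtain z where z: "z \<in> cyclotomic_ring N" "(\<Sum>i\<in>I. f i) ^ p = (\<Sum>i\<in>I. f i ^ p) + of_nat p * z"
    using insert by auto
  obtain w where w: "w \<in> cyclotomic_ring N"
     "(f i + (\<Sum>i\<in>I. f i)) ^ p = f i ^ p + (\<Sum>i\<in>I. f i) ^ p + of_nat p * w"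
    using prime_power_add_mod[OF p, of "f i" N "\<Sum>i\<in>I. f i"] insert.prems cyclotomic_ring_sum[of I f N] by auto
  show ?case
    using z w insert.hyps by (intro bexI[of _ "z + w"]) (auto simp: cyclotomic_ring_add algebra_simps)
qed (use prime_gt_0_nat[OF p] cyclotomic_ring.zero in \<open>auto simp: power_0_left\<close>)

text \<open>Linear forms over the rationals on the complex numbers stand in for the norm of the cyclotomic
  field: they detect nonzero elements.\<close>
lemma rational_functional:
  fixes \<alpha> :: complex
  assumes "\<alpha> \<noteq> 0"
  obtains f :: "complex \<Rightarrow> rat" where "\<And>x y. f (x + y) = f x + f y" "f \<alpha> = 1"
proof -
  interpret vector_space_pair "\<lambda>(q::rat) (x::complex). of_rat q * x" "\<lambda>(q::rat) (x::rat). q * x"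
    by unfold_locales (auto simp: algebra_simps of_rat_add of_rat_mult)
  have "vs1.independent {\<alpha>}" using assms by (simp add: vs1.dependent_single)
  from linear_independent_extend[OF this, of "\<lambda>_. 1"] obtain f where
    f: "Vector_Spaces.linear (\<lambda>q x. of_rat q * x) (\<lambda>q x. q * x) f" "f \<alpha> = 1" by auto
  from f(1) have "f (x + y) = f x + f y" for x y
    by (rule linear_add)
  with f(2) show ?thesis using that by blast
qed

text \<open>An additive map \<open>f\<close> into the rationals with \<open>f(\<alpha>) = 1\<close> takes values on \<open>\<int>[\<zeta>]\<close> whose denominators divide a
  common number \<open>E\<close>. If \<open>\<alpha> = pz\<close> with \<open>z\<close> in \<open>\<int>[\<zeta>]\<close>, then \<open>f(z) = 1/p\<close>, so \<open>p\<close> divides \<open>E\<close>.\<close>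
lemma finite_prime_divisors_cyclotomic:
  assumes "N > 0" "\<alpha> \<noteq> 0"
  shows "\<exists>A>0. \<forall>p>A. \<not> (\<exists>z\<in>cyclotomic_ring N. \<alpha> = of_nat p * z)"
proof -
  obtain f :: "complex \<Rightarrow> rat" where add: "\<And>x y. f (x + y) = f x + f y" and 1: "f \<alpha> = 1"
    using rational_functional[OF assms(2)] by metis
  have f0: "f 0 = 0" using add[of 0 0] by simp
  have diff: "f (x - y) = f x - f y" for x y using add[of "x - y" y] by simp
  have nat: "f (of_nat k * x) = of_nat k * f x" for k x
    by (induction k) (simp_all add: f0 add distrib_right)
  define g where "g j = f (e2pi (of_int j / real N))" for j :: int
  define E where "E = (\<Prod>j\<in>{0..<int N}. snd (quotient_of (g j)))"
  have Epos: "E > 0" unfolding E_def by (intro prod_pos) (simp add: quotient_of_denom_pos')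
  have g: "of_int E * g j \<in> \<int>" for j
  proof -
    have gj: "g j = g (j mod int N)" unfolding g_def using e2pi_mod[OF assms(1)] by simp
    have "snd (quotient_of (g (j mod int N))) dvd E"
      unfolding E_def using assms(1) by (intro dvd_prodI) auto
    then obtain c where c: "E = snd (quotient_of (g (j mod int N))) * c" by (elim dvdE)
    obtain a b where ab: "quotient_of (g (j mod int N)) = (a, b)" by force
    have "b > 0" using ab quotient_of_denom_pos by blast
    have "of_int E * g j = of_int (c * a)"
      using quotient_of_div[OF ab] \<open>b > 0\<close> unfolding gj c ab by simp
    then show ?thesis by simp
  qed
  have int: "of_int E * f z \<in> \<int>" if "z \<in> cyclotomic_ring N" for z
    using that
  proof induction
    case (plus x j) then show ?case using g[of j] by (simp add: add distrib_left g_def)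
  next
    case (minus x j) then show ?case using g[of j] by (simp add: diff right_diff_distrib g_def)
  qed (simp add: f0)
  show ?thesis
  proof (intro exI[of _ "nat E"] conjI allI impI notI)
    fix p assume p: "nat E < p" "\<exists>z\<in>cyclotomic_ring N. \<alpha> = of_nat p * z"
    then obtain z where z: "z \<in> cyclotomic_ring N" "\<alpha> = of_nat p * z" by auto
    from int[OF z(1)] obtain c where c: "of_int E * f z = of_int c" by (auto elim: Ints_cases)
    have "of_int E = of_int E * f \<alpha>" using 1 by simp
    also have "\<dots> = of_nat p * (of_int E * f z)" unfolding z(2) nat by simp
    also have "\<dots> = of_int (int p * c)" unfolding c by simp
    finally have "E = int p * c" by (simp only: of_int_eq_iff)
    then have "int p dvd E" by simp
    then have "int p \<le> E" using Epos zdvd_imp_le by blast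
    then show False using p by linarith
  qed (use Epos in simp)
qed

text \<open>Invariance of vanishing sums under the Galois group of the cyclotomic field, by Landau's argument
  for the irreducibility of the cyclotomic polynomials. Let \<open>S(k)\<close> be the sum of the \<open>k\<close>-th powers. If
  \<open>S(a) = 0\<close> and \<open>p\<close> is prime, then \<open>S(pa)\<close> is congruent to \<open>S(a)\<^sup>p = 0\<close> modulo \<open>p\<close>. As \<open>S\<close> has only
  finitely many values, \<open>S(pa) = 0\<close> follows for all primes \<open>p\<close> beyond some bound, and thus \<open>S(m) = 0\<close> for
  every \<open>m\<close> without small prime factors. Each residue class coprime to \<open>N\<close> contains such an \<open>m\<close>.\<close>
lemma vanishing_sum_galois:
  fixes c :: "'i \<Rightarrow> int"
  assumes N: "N > 0" and k: "coprime k N"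
    and vanish: "(\<Sum>i\<in>I. e2pi (of_int (c i) / real N)) = 0"
  shows "(\<Sum>i\<in>I. e2pi (of_int (int k * c i) / real N)) = 0"
proof -
  define S where "S k = (\<Sum>i\<in>I. e2pi (of_int (int k * c i) / real N))" for k :: nat
  have S_cong: "S (a + N * b) = S a" for a b
    unfolding S_def
  proof (intro sum.cong refl e2pi_diff_int)
    fix i
    have "of_int (int (a + N * b) * c i) / real N - of_int (int a * c i) / real N = of_int (int b * c i)"
      using N by (simp add: field_simps)
    then show "of_int (int (a + N * b) * c i) / real N - of_int (int a * c i) / real N \<in> \<int>" by simp
  qed
  have S_mod: "S a = S (a mod N)" for a
    using S_cong[of "a mod N" "a div N"] by simp
  have frob: "\<exists>z\<in>cyclotomic_ring N. S (p * a) = of_nat p * z" if "prime p" "S a = 0" for p a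
  proof -
    obtain z where z: "z \<in> cyclotomic_ring N"
      "S a ^ p = (\<Sum>i\<in>I. e2pi (of_int (int a * c i) / real N) ^ p) + of_nat p * z"
      using prime_power_sum_mod[OF \<open>prime p\<close>, of I "\<lambda>i. e2pi (of_int (int a * c i) / real N)" N,
          OF cyclotomic_ring_root]
      unfolding S_def by blast
    have "(\<Sum>i\<in>I. e2pi (of_int (int a * c i) / real N) ^ p) = S (p * a)"
      unfolding S_def by (intro sum.cong) (auto simp: e2pi_power mult_ac)
    with z that(2) prime_gt_0_nat[OF that(1)] have "S (p * a) = of_nat p * (- z)"
      by (simp add: add_eq_0_iff2 power_0_left)
    then show ?thesis using cyclotomic_ring_uminus[OF z(1)] by blast
  qed
  have "\<forall>a. \<exists>A. S a \<noteq> 0 \<longrightarrow> (\<forall>p>A. \<not> (\<exists>z\<in>cyclotomic_ring N. S a = of_nat p * z))"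
    using finite_prime_divisors_cyclotomic[OF N] by metis
  then obtain A where A: "\<And>a p. S a \<noteq> 0 \<Longrightarrow> p > A a \<Longrightarrow> \<not> (\<exists>z\<in>cyclotomic_ring N. S a = of_nat p * z)"
    by metis
  define A0 where "A0 = Max (A ` {..<N})"
  have big: "S (p * a) = 0" if "prime p" "p > A0" "S a = 0" for p a
  proof (rule ccontr)
    assume *: "S (p * a) \<noteq> 0"
    have "A ((p * a) mod N) \<le> A0" unfolding A0_def using N by (intro Max_ge) auto
    then have "p > A ((p * a) mod N)" using that by simp
    from A[OF _ this] frob[OF that(1,3)] * S_mod[of "p * a"] show False by metis
  qed
  have rough: "S m = 0" if "m > 0" "\<And>q. prime q \<Longrightarrow> q dvd m \<Longrightarrow> q > A0" for m
    using that
  proof (induction m rule: less_induct)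
    case (less m)
    show ?case
    proof (cases "m = 1")
      case True then show ?thesis using vanish by (simp add: S_def)
    next
      case False
      then obtain p where p: "prime p" "p dvd m" using prime_factor_nat by blast
      then obtain m' where m': "m = p * m'" by (elim dvdE)
      have "S m' = 0"
        using less.prems prime_gt_1_nat[OF p(1)] m' by (intro less.IH) auto
      then show ?thesis using big[OF p(1) less.prems(2)[OF p]] m' by simp
    qed
  qed
  \<comment> \<open>The number \<open>k + N Q\<close> has no prime factor \<open>q \<le> A0\<close>: each such \<open>q\<close> divides exactly one of the two summands.\<close>
  define Q where "Q = \<Prod>{q. prime q \<and> q \<le> A0 \<and> \<not> q dvd k}"
  have fin: "finite {q. prime q \<and> q \<le> A0 \<and> \<not> q dvd k}" by (rule finite_subset[of _ "{..A0}"]) auto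
  have "S (k + N * Q) = 0"
  proof (rule rough)
    have "Q > 0" unfolding Q_def by (intro prod_pos) (auto simp: prime_gt_0_nat)
    then show "k + N * Q > 0" using N by simp
  next
    fix q assume q: "prime q" "q dvd k + N * Q"
    show "q > A0"
    proof (rule ccontr)
      assume "\<not> q > A0"
      show False
      proof (cases "q dvd k")
        case True
        then have "q dvd N * Q" using q(2) dvd_add_right_iff by blast
        moreover have "\<not> q dvd N"
          using coprime_common_divisor[OF k True] q(1) by auto
        ultimately have "q dvd Q" using q(1) prime_dvd_mult_iff by blast
        then obtain r where "prime r" "\<not> r dvd k" "q dvd r"
          unfolding Q_def using q(1) by (auto simp: prime_dvd_prod_iff[OF fin q(1)])
        then show False using True q(1) primes_dvd_imp_eq by blast
      next
        case False
        then have "q dvd Q" unfolding Q_def using q \<open>\<not> q > A0\<close> fin by (intro dvd_prodI[of _ _ "\<lambda>x. x"]) auto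
        then have "q dvd k" using q(2) by (metis dvd_add_left_iff dvd_mult)
        then show False using False by simp
      qed
    qed
  qed
  then show ?thesis using S_cong by (simp add: S_def)
qed

section \<open>Parseval identities for the mask of a Hadamard triple\<close>

text \<open>A square matrix with orthonormal columns has orthonormal rows. The Gram matrix \<open>K\<close> of the rows
  satisfies \<open>tr K = tr KK\<^sup>* = #L\<close>, so \<open>K\<close> has squared Hilbert-Schmidt distance \<open>#L - 2#L + #B = 0\<close> from the
  identity matrix.\<close>
lemma dual_orthogonality:
  fixes M :: "'a \<Rightarrow> 'b \<Rightarrow> complex"
  assumes fin: "finite B" "finite L" and card: "card B = card L"
    and orth: "\<And>l l'. l \<in> L \<Longrightarrow> l' \<in> L \<Longrightarrow>
      (\<Sum>b\<in>B. cnj (M b l) * M b l') = (if l = l' then 1 else 0)"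
    and b: "b \<in> B" "b' \<in> B"
  shows "(\<Sum>l\<in>L. M b l * cnj (M b' l)) = (if b = b' then 1 else 0)"
proof -
  define K where "K b b' = (\<Sum>l\<in>L. M b l * cnj (M b' l))" for b b'
  define \<delta> :: "'a \<Rightarrow> 'a \<Rightarrow> complex" where "\<delta> b b' = (if b = b' then 1 else 0)" for b b'
  have "(\<Sum>b\<in>B. \<Sum>b'\<in>B. K b b' * cnj (K b b')) =
        (\<Sum>b\<in>B. \<Sum>b'\<in>B. \<Sum>l\<in>L. \<Sum>l'\<in>L. M b l * cnj (M b' l) * (cnj (M b l') * M b' l'))"
    by (simp add: K_def sum_product cnj_sum)
  also have "\<dots> = (\<Sum>b\<in>B. \<Sum>l\<in>L. \<Sum>b'\<in>B. \<Sum>l'\<in>L. M b l * cnj (M b' l) * (cnj (M b l') * M b' l'))"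
    by (intro sum.cong refl sum.swap)
  also have "\<dots> = (\<Sum>l\<in>L. \<Sum>b\<in>B. \<Sum>l'\<in>L. \<Sum>b'\<in>B. M b l * cnj (M b' l) * (cnj (M b l') * M b' l'))"
    by (subst sum.swap) (intro sum.cong refl sum.swap)
  also have "\<dots> = (\<Sum>l\<in>L. \<Sum>l'\<in>L. \<Sum>b\<in>B. \<Sum>b'\<in>B. M b l * cnj (M b' l) * (cnj (M b l') * M b' l'))"
    by (intro sum.cong refl sum.swap)
  also have "\<dots> = (\<Sum>l\<in>L. \<Sum>l'\<in>L. (\<Sum>b\<in>B. cnj (M b l') * M b l) * (\<Sum>b'\<in>B. cnj (M b' l) * M b' l'))"
    by (simp add: sum_product mult_ac)
  also have "\<dots> = (\<Sum>l\<in>L. \<Sum>l'\<in>L. if l = l' then 1 else 0)"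
    by (intro sum.cong refl) (simp add: orth)
  also have "\<dots> = of_nat (card L)" using fin by simp
  finally have 1: "(\<Sum>b\<in>B. \<Sum>b'\<in>B. K b b' * cnj (K b b')) = of_nat (card L)" .
  have "(\<Sum>b\<in>B. K b b) = (\<Sum>l\<in>L. \<Sum>b\<in>B. cnj (M b l) * M b l)"
    unfolding K_def by (subst sum.swap) (simp add: mult_ac)
  also have "\<dots> = of_nat (card L)" by (simp add: orth)
  finally have 2: "(\<Sum>b\<in>B. K b b) = of_nat (card L)" .
  then have 3: "(\<Sum>b\<in>B. cnj (K b b)) = of_nat (card L)"
    by (metis cnj_sum complex_cnj_of_nat)
  have expand: "of_real ((cmod (K b b' - \<delta> b b'))\<^sup>2) =
      K b b' * cnj (K b b') - (if b = b' then K b b + cnj (K b b) - 1 else 0)" for b b'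
    unfolding complex_norm_square by (auto simp: \<delta>_def algebra_simps)
  have "of_real (\<Sum>b\<in>B. \<Sum>b'\<in>B. (cmod (K b b' - \<delta> b b'))\<^sup>2) =
      (\<Sum>b\<in>B. \<Sum>b'\<in>B. K b b' * cnj (K b b')) -
      (\<Sum>b\<in>B. \<Sum>b'\<in>B. if b = b' then K b b + cnj (K b b) - 1 else 0)"
    by (simp only: of_real_sum expand sum_subtractf)
  also have "(\<Sum>b\<in>B. \<Sum>b'\<in>B. if b = b' then K b b + cnj (K b b) - 1 else 0) =
      (\<Sum>b\<in>B. K b b) + (\<Sum>b\<in>B. cnj (K b b)) - of_nat (card B)"
    using fin by (simp add: sum.distrib sum_subtractf)
  finally have "of_real (\<Sum>b\<in>B. \<Sum>b'\<in>B. (cmod (K b b' - \<delta> b b'))\<^sup>2) = (0 :: complex)"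
    unfolding 1 2 3 card by simp
  then have "(\<Sum>b\<in>B. \<Sum>b'\<in>B. (cmod (K b b' - \<delta> b b'))\<^sup>2) = 0" by (simp only: of_real_eq_0_iff)
  then have "(\<Sum>b'\<in>B. (cmod (K b b' - \<delta> b b'))\<^sup>2) = 0"
    using fin b by (subst (asm) sum_nonneg_eq_0_iff) (auto intro: sum_nonneg)
  then have "(cmod (K b b' - \<delta> b b'))\<^sup>2 = 0"
    using fin b by (subst (asm) sum_nonneg_eq_0_iff) auto
  then show ?thesis by (simp add: K_def \<delta>_def)
qed

locale digit_system =
  fixes N :: nat and B :: "int set"
  assumes N_ge_2: "N \<ge> 2" and finite_B: "finite B" and B_nonempty: "B \<noteq> {}"
begin

definition mask :: "real \<Rightarrow> complex" where
  "mask x = (\<Sum>b\<in>B. e2pi (of_int b * x)) / of_nat (card B)"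

primrec mask_prod :: "nat \<Rightarrow> real \<Rightarrow> complex" where
  "mask_prod 0 x = 1"
| "mask_prod (Suc n) x = mask_prod n x * mask (x / real N ^ Suc n)"

lemma N_pos: "N > 0" "real N > 0" using N_ge_2 by auto

lemma card_B_pos: "card B > 0"
  using finite_B B_nonempty by (simp add: card_gt_0_iff)

lemma mask_0 [simp]: "mask 0 = 1"
  using card_B_pos by (simp add: mask_def)

lemma norm_mask_le_1: "norm (mask x) \<le> 1"
proof -
  have "norm (\<Sum>b\<in>B. e2pi (of_int b * x)) \<le> (\<Sum>b\<in>B. 1)"
    by (rule sum_norm_le) simp
  then show ?thesis using card_B_pos by (simp add: mask_def norm_divide)
qed

lemma mask_diff_int: "x - y \<in> \<int> \<Longrightarrow> mask x = mask y"
  unfolding mask_def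
  by (intro arg_cong2[of _ _ _ _ "(/)"] sum.cong refl e2pi_diff_int)
     (simp flip: right_diff_distrib)

text \<open>This periodicity makes the choice of representatives modulo \<open>N\<^sup>n\<close> irrelevant for identities at
  level \<open>n\<close>.\<close>
lemma mask_prod_add_int: "mask_prod n (x + of_int (int N ^ n * k)) = mask_prod n x"
proof -
  have "mask_prod m (x + of_int (int N ^ n * k)) = mask_prod m x" if "m \<le> n" for m
    using that
  proof (induction m)
    case (Suc m)
    have "(x + of_int (int N ^ n * k)) / real N ^ Suc m - x / real N ^ Suc m = of_int (int N ^ (n - Suc m) * k)"
    proof -
      have "int N ^ n = int N ^ Suc m * int N ^ (n - Suc m)"
        using Suc.prems by (simp flip: power_add del: power_Suc)
      then show ?thesis using N_pos by (simp add: add_divide_distrib del: power_Suc)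
    qed
    then have "mask ((x + of_int (int N ^ n * k)) / real N ^ Suc m) = mask (x / real N ^ Suc m)"
      by (intro mask_diff_int) simp
    with Suc show ?case by simp
  qed simp
  then show ?thesis by simp
qed

lemma mask_prod_0 [simp]: "mask_prod n 0 = 1"
  by (induction n) auto

text \<open>Expanding the square leaves the diagonal terms only. The hypothesis will be met by \<open>s(l) = pl/N\<close> with
  \<open>l\<close> running through \<open>L\<close> or through all residues modulo \<open>N\<close>.\<close>
lemma mask_parseval:
  fixes s :: "'s \<Rightarrow> real"
  assumes orth: "\<And>b b'. b \<in> B \<Longrightarrow> b' \<in> B \<Longrightarrow> b \<noteq> b' \<Longrightarrow> (\<Sum>i\<in>S. e2pi (of_int (b - b') * s i)) = 0"
  shows "(\<Sum>i\<in>S. (cmod (mask (x + s i)))\<^sup>2) = real (card S) / real (card B)"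
proof -
  define m where "m = (of_nat (card B) :: complex)"
  have m: "m \<noteq> 0" using card_B_pos by (simp add: m_def)
  have "of_real ((cmod (mask (x + s i)))\<^sup>2) * m\<^sup>2 =
     (\<Sum>b\<in>B. \<Sum>b'\<in>B. e2pi (of_int (b - b') * x) * e2pi (of_int (b - b') * s i))" for i
  proof -
    have "of_real ((cmod (mask (x + s i)))\<^sup>2) * m\<^sup>2 =
       (\<Sum>b\<in>B. e2pi (of_int b * (x + s i))) * cnj (\<Sum>b\<in>B. e2pi (of_int b * (x + s i)))"
      unfolding complex_norm_square using m by (simp add: mask_def m_def power2_eq_square)
    also have "\<dots> = (\<Sum>b\<in>B. \<Sum>b'\<in>B. e2pi (of_int b * (x + s i)) * cnj (e2pi (of_int b' * (x + s i))))"
      by (simp add: cnj_sum sum_product)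
    also have "\<dots> = (\<Sum>b\<in>B. \<Sum>b'\<in>B. e2pi (of_int (b - b') * x) * e2pi (of_int (b - b') * s i))"
      unfolding e2pi_mult_cnj e2pi_add[symmetric] by (simp add: algebra_simps)
    finally show ?thesis .
  qed
  then have "of_real (\<Sum>i\<in>S. (cmod (mask (x + s i)))\<^sup>2) * m\<^sup>2 =
     (\<Sum>i\<in>S. \<Sum>b\<in>B. \<Sum>b'\<in>B. e2pi (of_int (b - b') * x) * e2pi (of_int (b - b') * s i))"
    by (simp add: sum_distrib_right)
  also have "\<dots> = (\<Sum>b\<in>B. \<Sum>i\<in>S. \<Sum>b'\<in>B. e2pi (of_int (b - b') * x) * e2pi (of_int (b - b') * s i))"
    by (rule sum.swap)
  also have "\<dots> = (\<Sum>b\<in>B. \<Sum>b'\<in>B. e2pi (of_int (b - b') * x) * (\<Sum>i\<in>S. e2pi (of_int (b - b') * s i)))"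
    unfolding sum_distrib_left by (intro sum.cong refl sum.swap)
  also have "\<dots> = (\<Sum>b\<in>B. \<Sum>b'\<in>B. if b = b' then of_nat (card S) else 0)"
    by (intro sum.cong refl) (auto simp: orth simp del: of_int_diff)
  also have "\<dots> = m * of_nat (card S)" using finite_B by (simp add: m_def)
  finally have "of_real (\<Sum>i\<in>S. (cmod (mask (x + s i)))\<^sup>2) * m = of_nat (card S)"
    using m by (simp add: power2_eq_square)
  then have "of_real (\<Sum>i\<in>S. (cmod (mask (x + s i)))\<^sup>2) = (of_real (real (card S) / real (card B)) :: complex)"
    using m by (simp add: m_def field_simps)
  then show ?thesis by (simp only: of_real_eq_iff)
qed

lemma hadamard_entry_cnj_mult:
  "cnj (hadamard_entry N B b l) * hadamard_entry N B b' l' =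
     e2pi (of_int (b' * l' - b * l) / real N) / of_nat (card B)"
proof -
  have entry: "hadamard_entry N B b l = e2pi (of_int (b * l) / real N) / of_real (sqrt (real (card B)))" for b l
    by (simp add: hadamard_entry_def e2pi_def cis_conv_exp mult_ac)
  have sq: "complex_of_real (sqrt (real (card B))) * complex_of_real (sqrt (real (card B))) = of_nat (card B)"
    by (simp flip: of_real_mult)
  have "cnj (hadamard_entry N B b l) * hadamard_entry N B b' l' =
    e2pi (of_int (b' * l') / real N) * cnj (e2pi (of_int (b * l) / real N)) / of_nat (card B)"
    unfolding entry by (simp flip: sq)
  then show ?thesis unfolding e2pi_mult_cnj by (simp add: diff_divide_distrib)
qed

end

text \<open>The condition \<open>0 \<in> L\<close> is a normalisation that makes the finite approximations of the spectrum
  nested; it is reached by a translation of \<open>L\<close> (\<open>hadamard_system_translate\<close> below).\<close>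
locale hadamard_system = digit_system +
  fixes L :: "int set"
  assumes hadamard: "hadamard_triple N B L" and card_less: "card B < N" and zero_in_L: "0 \<in> L"
begin

lemma finite_L: "finite L" and card_L: "card L = card B" and card_B_ge_2: "card B \<ge> 2"
  using hadamard by (auto simp: hadamard_triple_def)

lemma column_orthogonality:
  assumes "l \<in> L" "l' \<in> L" "l \<noteq> l'"
  shows "(\<Sum>b\<in>B. e2pi (of_int (b * (l' - l)) / real N)) = 0"
proof -
  have "(\<Sum>b\<in>B. e2pi (of_int (b * l' - b * l) / real N) / of_nat (card B)) = 0"
    using hadamard assms unfolding hadamard_triple_def hadamard_entry_cnj_mult by metis
  then show ?thesis using card_B_pos by (simp add: right_diff_distrib flip: sum_divide_distrib)
qed

lemma row_orthogonality:
  assumes "b \<in> B" "b' \<in> B" "b \<noteq> b'"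
  shows "(\<Sum>l\<in>L. e2pi (of_int ((b - b') * l) / real N)) = 0"
proof -
  have *: "(\<Sum>b\<in>B. cnj (hadamard_entry N B b l) * hadamard_entry N B b l') = (if l = l' then 1 else 0)"
    if "l \<in> L" "l' \<in> L" for l l'
    using hadamard that by (simp add: hadamard_triple_def)
  have "(\<Sum>l\<in>L. hadamard_entry N B b l * cnj (hadamard_entry N B b' l)) = 0"
    using dual_orthogonality[OF finite_B finite_L card_L[symmetric] * assms(1,2)] assms(3) by simp
  then have "(\<Sum>l\<in>L. e2pi (of_int (b * l - b' * l) / real N) / of_nat (card B)) = 0"
    by (subst (asm) mult.commute) (simp only: hadamard_entry_cnj_mult)
  then show ?thesis using card_B_pos by (simp add: left_diff_distrib flip: sum_divide_distrib)
qed

lemma digits_distinct_mod: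
  assumes "b \<in> B" "b' \<in> B" "b \<noteq> b'"
  shows "\<not> int N dvd b - b'"
proof
  assume "int N dvd b - b'"
  then obtain c where c: "b - b' = int N * c" by (elim dvdE)
  have "e2pi (of_int ((b - b') * l) / real N) = 1" for l
  proof -
    have "of_int ((b - b') * l) / real N = of_int (c * l)" using N_pos by (simp add: c)
    then show ?thesis by (simp only: e2pi_of_int)
  qed
  then have "(\<Sum>l\<in>L. e2pi (of_int ((b - b') * l) / real N)) = of_nat (card L)" by simp
  then show False using row_orthogonality[OF assms] card_L card_B_pos by simp
qed

lemma mask_frame_L:
  assumes p: "coprime p N"
  shows "(\<Sum>l\<in>L. (cmod (mask (x + real p * of_int l / real N)))\<^sup>2) = 1"
proof -
  have "(\<Sum>l\<in>L. (cmod (mask (x + real p * of_int l / real N)))\<^sup>2) = real (card L) / real (card B)"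
  proof (rule mask_parseval)
    fix b b' assume "b \<in> B" "b' \<in> B" "b \<noteq> b'"
    from vanishing_sum_galois[OF N_pos(1) p row_orthogonality[OF this]]
    show "(\<Sum>l\<in>L. e2pi (of_int (b - b') * (real p * of_int l / real N))) = 0"
      by (simp add: mult_ac)
  qed
  then show ?thesis using card_L card_B_pos by simp
qed

lemma mask_frame_residues:
  assumes p: "coprime p N"
  shows "(\<Sum>r<N. (cmod (mask (x + real p * real r / real N)))\<^sup>2) = real N / real (card B)"
proof -
  have "(\<Sum>r<N. (cmod (mask (x + real p * real r / real N)))\<^sup>2) = real (card {..<N}) / real (card B)"
  proof (rule mask_parseval)
    fix b b' assume b: "b \<in> B" "b' \<in> B" "b \<noteq> b'"
    define w where "w = e2pi (of_int ((b - b') * int p) / real N)"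
    have w1: "w \<noteq> 1"
    proof
      assume "w = 1"
      then obtain k :: int where "of_int ((b - b') * int p) / real N = of_int k"
        unfolding w_def using e2pi_eq_1D by blast
      then have "of_int ((b - b') * int p) = (of_int (int N * k) :: real)" using N_pos by (simp add: field_simps)
      then have "(b - b') * int p = int N * k" by (simp only: of_int_eq_iff)
      then have "int N dvd (b - b') * int p" by simp
      moreover have "coprime (int N) (int p)" using p by (simp add: coprime_commute)
      ultimately have "int N dvd b - b'" by (simp add: coprime_dvd_mult_left_iff)
      then show False using digits_distinct_mod b by blast
    qed
    have wN: "w ^ N = 1"
    proof -
      have "real N * (of_int ((b - b') * int p) / real N) = of_int ((b - b') * int p)" using N_pos by simp
      then show ?thesis unfolding w_def e2pi_power by (simp only: e2pi_of_int)
    qed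
    have "(\<Sum>r<N. e2pi (of_int (b - b') * (real p * real r / real N))) = (\<Sum>r<N. w ^ r)"
      by (intro sum.cong refl) (simp add: w_def e2pi_power mult_ac)
    also have "\<dots> = 0" using w1 wN by (simp add: sum_gp_strict)
    finally show "(\<Sum>r<N. e2pi (of_int (b - b') * (real p * real r / real N))) = 0" .
  qed
  then show ?thesis by simp
qed

end

section \<open>The self-similar measure and its Fourier transform\<close>

text \<open>The normalisation with \<open>exp(2\<pi>ixt)\<close> instead of \<open>exp(ixt)\<close> makes integers the periods of the mask.\<close>
abbreviation ft :: "real measure \<Rightarrow> real \<Rightarrow> complex" where
  "ft \<nu> x \<equiv> char \<nu> (2 * pi * x)"

lemma ft_eq_integral: "ft \<nu> x = (LINT t|\<nu>. e2pi (x * t))"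
  by (simp add: char_def e2pi_def cis_conv_exp mult_ac)

lemma borel_measurable_e2pi [measurable]: "e2pi \<in> borel_measurable borel"
  unfolding e2pi_def[abs_def] by (intro borel_measurable_continuous_onI continuous_intros)

context digit_system
begin

abbreviation digit_measure :: "int measure" where
  "digit_measure \<equiv> uniform_count_measure B"

abbreviation digit_step :: "int \<times> real \<Rightarrow> real" where
  "digit_step \<equiv> (\<lambda>(b, x). ifs_map N b x)"

lemma prob_space_digit_measure: "prob_space digit_measure"
  using finite_B B_nonempty by (rule prob_space_uniform_count_measure)

lemma measurable_digit_measure: "f \<in> digit_measure \<rightarrow>\<^sub>M M" if "f \<in> B \<rightarrow> space M"
proof -
  have "f \<in> count_space B \<rightarrow>\<^sub>M M" using that by simp
  then show ?thesis
    by (subst measurable_cong_sets[OF sets_uniform_count_measure_count_space refl])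
qed

lemma measurable_ifs_map: "ifs_map N b \<in> borel \<rightarrow>\<^sub>M borel"
  unfolding ifs_map_def by measurable

lemma measurable_digit_step:
  assumes "sets \<nu> = sets borel"
  shows "digit_step \<in> digit_measure \<Otimes>\<^sub>M \<nu> \<rightarrow>\<^sub>M borel"
proof -
  have [measurable]: "(\<lambda>b. of_int b :: real) \<in> borel_measurable digit_measure"
    by (rule measurable_digit_measure) simp
  have [measurable_cong]: "sets \<nu> = sets borel" by fact
  show ?thesis unfolding ifs_map_def by measurable
qed

lemma integral_digit_step:
  fixes g :: "real \<Rightarrow> 'b :: {banach, second_countable_topology}"
  assumes \<nu>: "prob_space \<nu>" "sets \<nu> = sets borel"
    and g: "g \<in> borel_measurable borel" "\<And>x. norm (g x) \<le> C"
  shows "(LINT z|(digit_measure \<Otimes>\<^sub>M \<nu>). g (digit_step z)) =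
    (\<Sum>b\<in>B. LINT x|\<nu>. g (ifs_map N b x)) /\<^sub>R real (card B)"
proof -
  interpret U: prob_space digit_measure by (rule prob_space_digit_measure)
  interpret \<nu>: prob_space \<nu> by fact
  interpret P: pair_prob_space digit_measure \<nu> ..
  have "integrable (digit_measure \<Otimes>\<^sub>M \<nu>) (\<lambda>z. g (digit_step z))"
    by (rule P.integrable_const_bound[of _ C])
       (use g measurable_compose[OF measurable_digit_step[OF \<nu>(2)] g(1)] in auto)
  from P.integral_fst'[OF this]
  have "(LINT z|(digit_measure \<Otimes>\<^sub>M \<nu>). g (digit_step z)) =
        (LINT b|digit_measure. LINT x|\<nu>. g (ifs_map N b x))" by simp
  also have "\<dots> = (\<Sum>b\<in>B. (1 / real (card B)) *\<^sub>R (LINT x|\<nu>. g (ifs_map N b x)))"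
    unfolding uniform_count_measure_def
    by (rule lebesgue_integral_point_measure_finite) (use finite_B in auto)
  finally show ?thesis by (simp add: scaleR_sum_right inverse_eq_divide)
qed

lemma measure_digit_step:
  assumes \<nu>: "prob_space \<nu>" "sets \<nu> = sets borel" and A: "A \<in> sets borel"
  shows "measure (distr (digit_measure \<Otimes>\<^sub>M \<nu>) borel digit_step) A =
    (1 / real (card B)) * (\<Sum>b\<in>B. measure (distr \<nu> borel (ifs_map N b)) A)"
proof -
  interpret U: prob_space digit_measure by (rule prob_space_digit_measure)
  interpret \<nu>: prob_space \<nu> by fact
  interpret P: pair_prob_space digit_measure \<nu> ..
  have meas: "ifs_map N b \<in> \<nu> \<rightarrow>\<^sub>M borel" for b
    using measurable_ifs_map \<nu>(2) by (simp cong: measurable_cong_sets)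
  interpret D: prob_space "distr (digit_measure \<Otimes>\<^sub>M \<nu>) borel digit_step"
    by (rule P.prob_space_distr[OF measurable_digit_step[OF \<nu>(2)]])
  have "measure (distr (digit_measure \<Otimes>\<^sub>M \<nu>) borel digit_step) A =
    (LINT z|(distr (digit_measure \<Otimes>\<^sub>M \<nu>) borel digit_step). indicator A z)"
    using A by simp
  also have "\<dots> = (LINT z|(digit_measure \<Otimes>\<^sub>M \<nu>). indicator A (digit_step z))"
    by (rule integral_distr[OF measurable_digit_step[OF \<nu>(2)]]) (use A in simp)
  also have "\<dots> = (\<Sum>b\<in>B. LINT x|\<nu>. indicator A (ifs_map N b x)) /\<^sub>R real (card B)"
    by (rule integral_digit_step[OF \<nu>, of _ 1]) (use A in \<open>auto simp: indicator_def\<close>)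
  also have "(\<Sum>b\<in>B. LINT x|\<nu>. indicator A (ifs_map N b x)) =
     (\<Sum>b\<in>B. LINT x|(distr \<nu> borel (ifs_map N b)). indicator A x :: real)"
    by (intro sum.cong refl integral_distr[symmetric] meas) (use A in simp)
  also have "\<dots> = (\<Sum>b\<in>B. measure (distr \<nu> borel (ifs_map N b)) A)"
    using A by simp
  finally show ?thesis by (simp add: inverse_eq_divide)
qed

text \<open>The invariance equation says that \<open>\<nu>\<close> is the law of \<open>(x + b)/N\<close> for a uniformly distributed digit \<open>b\<close> and an
  independent \<open>x\<close> with law \<open>\<nu>\<close>. In this form it can be tested against arbitrary bounded functions and
  verified for a random series.\<close>
lemma is_self_similar_measure_iff:
  "is_self_similar_measure N B \<nu> \<longleftrightarrow>
     prob_space \<nu> \<and> sets \<nu> = sets borel \<and> distr (digit_measure \<Otimes>\<^sub>M \<nu>) borel digit_step = \<nu>"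
proof -
  have "(\<forall>A\<in>sets borel. measure \<nu> A =
        (1 / real (card B)) * (\<Sum>b\<in>B. measure (distr \<nu> borel (ifs_map N b)) A)) \<longleftrightarrow>
        distr (digit_measure \<Otimes>\<^sub>M \<nu>) borel digit_step = \<nu>"
    if \<nu>: "prob_space \<nu>" "sets \<nu> = sets borel"
  proof -
    interpret U: prob_space digit_measure by (rule prob_space_digit_measure)
    interpret \<nu>: prob_space \<nu> by fact
    interpret P: pair_prob_space digit_measure \<nu> ..
    interpret D: prob_space "distr (digit_measure \<Otimes>\<^sub>M \<nu>) borel digit_step"
      by (rule P.prob_space_distr[OF measurable_digit_step[OF \<nu>(2)]])
    show ?thesis
    proof
      assume *: "\<forall>A\<in>sets borel. measure \<nu> A =
        (1 / real (card B)) * (\<Sum>b\<in>B. measure (distr \<nu> borel (ifs_map N b)) A)"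
      show "distr (digit_measure \<Otimes>\<^sub>M \<nu>) borel digit_step = \<nu>"
      proof (rule measure_eqI)
        fix A assume "A \<in> sets (distr (digit_measure \<Otimes>\<^sub>M \<nu>) borel digit_step)"
        then have A: "A \<in> sets borel" by simp
        then have "measure (distr (digit_measure \<Otimes>\<^sub>M \<nu>) borel digit_step) A = measure \<nu> A"
          using * measure_digit_step[OF \<nu> A] by simp
        then show "emeasure (distr (digit_measure \<Otimes>\<^sub>M \<nu>) borel digit_step) A = emeasure \<nu> A"
          by (simp only: D.emeasure_eq_measure \<nu>.emeasure_eq_measure)
      qed (simp add: \<nu>)
    next
      assume "distr (digit_measure \<Otimes>\<^sub>M \<nu>) borel digit_step = \<nu>"
      then show "\<forall>A\<in>sets borel. measure \<nu> A =
        (1 / real (card B)) * (\<Sum>b\<in>B. measure (distr \<nu> borel (ifs_map N b)) A)"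
        using measure_digit_step[OF \<nu>] by simp
    qed
  qed
  then show ?thesis unfolding is_self_similar_measure_def by blast
qed

lemma self_similar_real_distribution:
  "is_self_similar_measure N B \<nu> \<Longrightarrow> real_distribution \<nu>"
  unfolding is_self_similar_measure_iff real_distribution_def real_distribution_axioms_def by simp

lemma ft_self_similar:
  assumes "is_self_similar_measure N B \<nu>"
  shows "ft \<nu> x = mask (x / real N) * ft \<nu> (x / real N)"
proof -
  have \<nu>: "prob_space \<nu>" "sets \<nu> = sets borel" "distr (digit_measure \<Otimes>\<^sub>M \<nu>) borel digit_step = \<nu>"
    using assms unfolding is_self_similar_measure_iff by auto
  have "ft \<nu> x = (LINT t|(distr (digit_measure \<Otimes>\<^sub>M \<nu>) borel digit_step). e2pi (x * t))"
    unfolding ft_eq_integral \<nu>(3) ..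
  also have "\<dots> = (LINT z|(digit_measure \<Otimes>\<^sub>M \<nu>). e2pi (x * digit_step z))"
    by (rule integral_distr[OF measurable_digit_step[OF \<nu>(2)]]) simp
  also have "\<dots> = (\<Sum>b\<in>B. LINT t|\<nu>. e2pi (x * ifs_map N b t)) /\<^sub>R real (card B)"
    by (rule integral_digit_step[OF \<nu>(1,2), of "\<lambda>t. e2pi (x * t)" 1]) auto
  also have "(\<Sum>b\<in>B. LINT t|\<nu>. e2pi (x * ifs_map N b t)) =
     (\<Sum>b\<in>B. e2pi (of_int b * (x / real N)) * ft \<nu> (x / real N))"
  proof (rule sum.cong)
    fix b
    have "e2pi (x * ifs_map N b t) = e2pi (of_int b * (x / real N)) * e2pi (x / real N * t)" for t
      unfolding e2pi_add[symmetric] using N_pos by (simp add: ifs_map_def field_simps)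
    then show "(LINT t|\<nu>. e2pi (x * ifs_map N b t)) =
      e2pi (of_int b * (x / real N)) * ft \<nu> (x / real N)"
      unfolding ft_eq_integral by simp
  qed simp
  finally show ?thesis
    by (simp add: mask_def sum_distrib_right[symmetric] scaleR_conv_of_real divide_inverse)
qed

lemma ft_eq_mask_prod:
  assumes "is_self_similar_measure N B \<nu>"
  shows "ft \<nu> x = mask_prod n x * ft \<nu> (x / real N ^ n)"
proof (induction n)
  case (Suc n)
  then show ?case using ft_self_similar[OF assms, of "x / real N ^ n"] N_pos by (simp add: mult.commute mult.left_commute)
qed simp

lemma scaled_tendsto_0: "(\<lambda>n. x / real N ^ n) \<longlonglongrightarrow> 0"
  using LIMSEQ_divide_realpow_zero[of "real N" x] N_ge_2 by simp

lemma ft_scaled_tendsto_1: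
  assumes "real_distribution \<nu>"
  shows "(\<lambda>n. ft \<nu> (x / real N ^ n)) \<longlonglongrightarrow> 1"
proof -
  interpret real_distribution \<nu> by fact
  have "(\<lambda>n. 2 * pi * (x / real N ^ n)) \<longlonglongrightarrow> 2 * pi * 0"
    by (intro tendsto_intros scaled_tendsto_0)
  from isCont_tendsto_compose[OF isCont_char this] char_zero show ?thesis by simp
qed

lemma mask_prod_tendsto_ft:
  assumes "is_self_similar_measure N B \<nu>"
  shows "(\<lambda>n. mask_prod n x) \<longlonglongrightarrow> ft \<nu> x"
proof -
  note lim = ft_scaled_tendsto_1[OF self_similar_real_distribution[OF assms], of x]
  have "(\<lambda>n. ft \<nu> x / ft \<nu> (x / real N ^ n)) \<longlonglongrightarrow> ft \<nu> x / 1"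
    by (intro tendsto_intros lim) simp
  moreover have "\<forall>\<^sub>F n in sequentially. ft \<nu> x / ft \<nu> (x / real N ^ n) = mask_prod n x"
    using tendsto_imp_eventually_ne[OF lim one_neq_zero]
  proof (rule eventually_mono)
    fix n assume "ft \<nu> (x / real N ^ n) \<noteq> 0"
    then show "ft \<nu> x / ft \<nu> (x / real N ^ n) = mask_prod n x"
      using ft_eq_mask_prod[OF assms, of x n] by (metis nonzero_mult_div_cancel_right)
  qed
  ultimately show ?thesis using Lim_transform_eventually by fastforce
qed

text \<open>The Fourier transform is determined as the limit of the products of masks.\<close>
lemma self_similar_measure_unique:
  assumes "is_self_similar_measure N B \<nu>" "is_self_similar_measure N B \<nu>'"
  shows "\<nu> = \<nu>'"
proof (rule Levy_uniqueness)
  show "char \<nu> = char \<nu>'"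
  proof
    fix t
    have "ft \<nu> (t / (2 * pi)) = ft \<nu>' (t / (2 * pi))"
      using LIMSEQ_unique[OF mask_prod_tendsto_ft[OF assms(1)] mask_prod_tendsto_ft[OF assms(2)]] .
    then show "char \<nu> t = char \<nu>' t" by simp
  qed
qed (use assms self_similar_real_distribution in auto)

text \<open>The law of \<open>\<Sum>i. \<omega>\<^sub>i / N\<^bsup>i+1\<^esup>\<close> for independent uniform digits \<open>\<omega>\<^sub>i\<close>: splitting off the first digit gives the
  invariance equation. The bound on the support will be needed for the density of the exponentials.\<close>
lemma self_similar_measure_exists:
  "\<exists>\<nu>. is_self_similar_measure N B \<nu> \<and> (\<exists>K. AE x in \<nu>. \<bar>x\<bar> \<le> K)"
proof -
  interpret U: prob_space digit_measure by (rule prob_space_digit_measure)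
  interpret sequence_space digit_measure ..
  define X :: "(nat \<Rightarrow> int) \<Rightarrow> real" where "X \<omega> = (\<Sum>i. of_int (\<omega> i) * (1 / real N) ^ Suc i)" for \<omega>
  define D where "D = Max ((\<lambda>b. \<bar>of_int b\<bar> :: real) ` B)"
  have D: "\<bar>of_int b\<bar> \<le> D" if "b \<in> B" for b unfolding D_def using that finite_B by auto
  have geom: "summable (\<lambda>i. D * (1 / real N) ^ Suc i)"
    using N_ge_2 by (intro summable_mult) (simp add: summable_geometric_iff)
  have digits: "\<omega> i \<in> B" if "\<omega> \<in> space S" for \<omega> i
    using that by (auto simp: space_PiM space_uniform_count_measure)
  have bound: "norm (of_int (\<omega> i) * (1 / real N) ^ Suc i) \<le> D * (1 / real N) ^ Suc i" if "\<omega> \<in> space S" for \<omega> i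
    using D[OF digits[OF that, of i]] N_pos by (simp add: abs_mult divide_right_mono)
  have summ: "summable (\<lambda>i. of_int (\<omega> i) * (1 / real N) ^ Suc i)" if "\<omega> \<in> space S" for \<omega>
    using geom bound[OF that] by (rule summable_comparison_test')
  have Xbound: "\<bar>X \<omega>\<bar> \<le> (\<Sum>i. D * (1 / real N) ^ Suc i)" if "\<omega> \<in> space S" for \<omega>
    using norm_suminf_le[OF bound[OF that] geom] by (simp add: X_def)
  have [measurable]: "(\<lambda>b. of_int b :: real) \<in> borel_measurable digit_measure"
    by (rule measurable_digit_measure) simp
  have X[measurable]: "X \<in> borel_measurable S" unfolding X_def by measurable
  have step: "X (case_nat b \<omega>) = ifs_map N b (X \<omega>)" if "b \<in> B" "\<omega> \<in> space S" for b \<omega>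
  proof -
    have "case_nat b \<omega> \<in> space S"
      using that by (auto simp: space_PiM space_uniform_count_measure PiE_iff split: nat.split)
    from suminf_split_head[OF summ[OF this]]
    have "X (case_nat b \<omega>) = of_int b / real N + (\<Sum>i. of_int (\<omega> i) * (1 / real N) ^ Suc i * (1 / real N))"
      by (simp add: X_def)
    also have "(\<Sum>i. of_int (\<omega> i) * (1 / real N) ^ Suc i * (1 / real N)) = X \<omega> * (1 / real N)"
      unfolding X_def by (rule suminf_mult2[symmetric]) (rule summ[OF that(2)])
    finally show ?thesis by (simp add: ifs_map_def add_divide_distrib)
  qed
  define \<nu> where "\<nu> = distr S borel X"
  interpret \<nu>: prob_space \<nu> unfolding \<nu>_def by (rule P.prob_space_distr) simp
  have "distr (digit_measure \<Otimes>\<^sub>M \<nu>) borel digit_step =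
    distr (distr (digit_measure \<Otimes>\<^sub>M S) (digit_measure \<Otimes>\<^sub>M borel) (\<lambda>(b, \<omega>). (b, X \<omega>))) borel digit_step"
  proof -
    have "digit_measure \<Otimes>\<^sub>M \<nu> = distr digit_measure digit_measure (\<lambda>b. b) \<Otimes>\<^sub>M \<nu>" by simp
    also have "\<dots> = distr (digit_measure \<Otimes>\<^sub>M S) (digit_measure \<Otimes>\<^sub>M borel) (\<lambda>(b, \<omega>). (b, X \<omega>))"
      unfolding \<nu>_def by (rule pair_measure_distr) (auto simp: \<nu>_def[symmetric] \<nu>.sigma_finite_measure_axioms)
    finally show ?thesis by simp
  qed
  also have "\<dots> = distr (digit_measure \<Otimes>\<^sub>M S) borel (digit_step \<circ> (\<lambda>(b, \<omega>). (b, X \<omega>)))"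
    by (rule distr_distr) (auto intro!: measurable_digit_step)
  also have "\<dots> = distr (digit_measure \<Otimes>\<^sub>M S) borel (X \<circ> (\<lambda>(b, \<omega>). case_nat b \<omega>))"
    by (rule distr_cong) (auto simp: space_pair_measure space_uniform_count_measure step)
  also have "\<dots> = distr (distr (digit_measure \<Otimes>\<^sub>M S) S (\<lambda>(b, \<omega>). case_nat b \<omega>)) borel X"
    by (rule distr_distr[symmetric]) auto
  also have "\<dots> = \<nu>" unfolding PiM_iter \<nu>_def ..
  finally have "is_self_similar_measure N B \<nu>"
    unfolding is_self_similar_measure_iff using \<nu>.prob_space_axioms by (simp add: \<nu>_def)
  moreover have "AE x in \<nu>. \<bar>x\<bar> \<le> (\<Sum>i. D * (1 / real N) ^ Suc i)"
    unfolding \<nu>_def by (subst AE_distr_iff) (use Xbound in auto)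
  ultimately show ?thesis by blast
qed

lemma is_self_similar_self_similar_measure:
  "is_self_similar_measure N B (self_similar_measure N B)"
  unfolding self_similar_measure_def
  using self_similar_measure_exists self_similar_measure_unique by (metis theI)

lemma self_similar_measure_bounded: "\<exists>K. AE x in self_similar_measure N B. \<bar>x\<bar> \<le> K"
  using self_similar_measure_exists self_similar_measure_unique is_self_similar_self_similar_measure
  by metis

end

section \<open>The Parseval criterion for spectra\<close>

locale bounded_distribution = real_distribution +
  fixes K :: real
  assumes bounded: "AE x in M. \<bar>x\<bar> \<le> K"
begin

lemma integrable_e2pi: "integrable M (\<lambda>x. e2pi (l * x))"
  by (rule integrable_const_bound[of _ 1]) auto

lemma integral_e2pi: "(LINT x|M. e2pi (l * x)) = ft M l"
  by (simp add: ft_eq_integral)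

lemma ft_uminus: "ft M (- x) = cnj (ft M x)"
proof -
  have "cnj (ft M x) = (LINT t|M. cnj (e2pi (x * t)))"
    unfolding ft_eq_integral by (rule Bochner_Integration.integral_cnj[symmetric])
  then show ?thesis unfolding ft_eq_integral by (simp add: cnj_e2pi)
qed

lemma ft_0: "ft M 0 = 1"
  using char_zero by simp

lemma L2_functions_bounded:
  assumes [measurable]: "f \<in> borel_measurable M" and "\<And>x. norm (f x) \<le> C"
  shows "f \<in> L2_functions M"
proof -
  have "integrable M (\<lambda>x. (norm (f x))\<^sup>2)"
    by (rule integrable_const_bound[of _ "C\<^sup>2"]) (use assms in \<open>auto intro!: power_mono\<close>)
  then show ?thesis by (simp add: L2_functions_def)
qed

lemma norm_add_squared_le: "(norm (a + b))\<^sup>2 \<le> 2 * (norm a)\<^sup>2 + 2 * (norm (b :: complex))\<^sup>2"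
proof -
  have "(norm (a + b))\<^sup>2 \<le> (norm a + norm b)\<^sup>2" by (intro power_mono norm_triangle_ineq) simp
  also have "\<dots> \<le> 2 * (norm a)\<^sup>2 + 2 * (norm b)\<^sup>2"
    using sum_squares_bound[of "norm a" "norm b"] by (simp add: power2_sum)
  finally show ?thesis .
qed

lemma L2_functions_add:
  assumes "f \<in> L2_functions M" "g \<in> L2_functions M"
  shows "(\<lambda>x. f x + g x) \<in> L2_functions M"
proof -
  have [measurable]: "f \<in> borel_measurable M" "g \<in> borel_measurable M"
    and int: "integrable M (\<lambda>x. (norm (f x))\<^sup>2)" "integrable M (\<lambda>x. (norm (g x))\<^sup>2)"
    using assms by (auto simp: L2_functions_def)
  have "integrable M (\<lambda>x. (norm (f x + g x))\<^sup>2)"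
    by (rule Bochner_Integration.integrable_bound[of _ "\<lambda>x. 2 * (norm (f x))\<^sup>2 + 2 * (norm (g x))\<^sup>2"])
       (use int norm_add_squared_le in auto)
  then show ?thesis by (simp add: L2_functions_def)
qed

lemma L2_functions_cmult:
  "f \<in> L2_functions M \<Longrightarrow> (\<lambda>x. c * f x) \<in> L2_functions M"
  by (auto simp: L2_functions_def norm_mult power_mult_distrib)

lemma L2_functions_diff:
  "f \<in> L2_functions M \<Longrightarrow> g \<in> L2_functions M \<Longrightarrow> (\<lambda>x. f x - g x) \<in> L2_functions M"
  using L2_functions_add[of f "\<lambda>x. -1 * g x"] L2_functions_cmult[of g "-1"] by simp

lemma L2_functions_trig_sum:
  "finite F \<Longrightarrow> (\<lambda>x. \<Sum>l\<in>F. c l * e2pi (l * x)) \<in> L2_functions M"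
  by (rule L2_functions_bounded[of _ "\<Sum>l\<in>F. norm (c l)"])
     (auto intro!: sum_norm_le simp: norm_mult)

lemma integral_norm_add_squared_le:
  assumes "f \<in> L2_functions M" "g \<in> L2_functions M"
  shows "(LINT x|M. (norm (f x + g x))\<^sup>2) \<le> 2 * (LINT x|M. (norm (f x))\<^sup>2) + 2 * (LINT x|M. (norm (g x))\<^sup>2)"
proof -
  have "(LINT x|M. (norm (f x + g x))\<^sup>2) \<le> (LINT x|M. 2 * (norm (f x))\<^sup>2 + 2 * (norm (g x))\<^sup>2)"
    using assms L2_functions_add[OF assms] norm_add_squared_le
    by (intro integral_mono) (auto simp: L2_functions_def)
  then show ?thesis using assms by (simp add: L2_functions_def)
qed

text \<open>Membership in the closed span of the exponentials with frequencies in \<open>\<Lambda>\<close>. Squared errors avoid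
  Minkowski's inequality: \<open>|a + b|\<^sup>2 \<le> 2|a|\<^sup>2 + 2|b|\<^sup>2\<close> suffices for all closure properties.\<close>
definition approximable :: "real set \<Rightarrow> (real \<Rightarrow> complex) \<Rightarrow> bool" where
  "approximable \<Lambda> f \<longleftrightarrow> f \<in> L2_functions M \<and>
     (\<forall>\<epsilon>>0. \<exists>F c. finite F \<and> F \<subseteq> \<Lambda> \<and>
        (LINT x|M. (norm (f x - (\<Sum>l\<in>F. c l * e2pi (l * x))))\<^sup>2) < \<epsilon>)"

lemma approximableE:
  assumes "approximable \<Lambda> f" "\<epsilon> > 0"
  obtains F c where "finite F" "F \<subseteq> \<Lambda>"
    "(LINT x|M. (norm (f x - (\<Sum>l\<in>F. c l * e2pi (l * x))))\<^sup>2) < \<epsilon>"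
  using assms unfolding approximable_def by blast

lemma approximable_limit:
  assumes f: "f \<in> L2_functions M"
    and g: "\<And>\<epsilon>. \<epsilon> > 0 \<Longrightarrow> \<exists>g. approximable \<Lambda> g \<and> (LINT x|M. (norm (f x - g x))\<^sup>2) < \<epsilon>"
  shows "approximable \<Lambda> f"
  unfolding approximable_def
proof (intro conjI allI impI)
  fix \<epsilon> :: real assume "\<epsilon> > 0"
  then obtain g where g: "approximable \<Lambda> g" "(LINT x|M. (norm (f x - g x))\<^sup>2) < \<epsilon> / 4"
    using assms(2)[of "\<epsilon> / 4"] by auto
  have "\<epsilon> / 4 > 0" using \<open>\<epsilon> > 0\<close> by simp
  from approximableE[OF g(1) this] obtain F c where F: "finite F" "F \<subseteq> \<Lambda>"
    "(LINT x|M. (norm (g x - (\<Sum>l\<in>F. c l * e2pi (l * x))))\<^sup>2) < \<epsilon> / 4" .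
  have gL: "g \<in> L2_functions M" using g by (simp add: approximable_def)
  have "(LINT x|M. (norm (f x - (\<Sum>l\<in>F. c l * e2pi (l * x))))\<^sup>2) < \<epsilon>"
    using integral_norm_add_squared_le[OF L2_functions_diff[OF f gL]
        L2_functions_diff[OF gL L2_functions_trig_sum[OF F(1), of c]]] g(2) F(3) by simp
  then show "\<exists>F c. finite F \<and> F \<subseteq> \<Lambda> \<and> (LINT x|M. (norm (f x - (\<Sum>l\<in>F. c l * e2pi (l * x))))\<^sup>2) < \<epsilon>"
    using F by blast
qed (rule f)

lemma approximable_add:
  assumes f: "approximable \<Lambda> f" and g: "approximable \<Lambda> g"
  shows "approximable \<Lambda> (\<lambda>x. f x + g x)"
  unfolding approximable_def
proof (intro conjI allI impI)
  have L: "f \<in> L2_functions M" "g \<in> L2_functions M" using assms by (auto simp: approximable_def)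
  then show "(\<lambda>x. f x + g x) \<in> L2_functions M" by (rule L2_functions_add)
  fix \<epsilon> :: real assume "\<epsilon> > 0"
  then have "\<epsilon> / 4 > 0" by simp
  from approximableE[OF f this] obtain F c where F: "finite F" "F \<subseteq> \<Lambda>"
    "(LINT x|M. (norm (f x - (\<Sum>l\<in>F. c l * e2pi (l * x))))\<^sup>2) < \<epsilon> / 4" .
  from approximableE[OF g \<open>\<epsilon> / 4 > 0\<close>] obtain G d where G: "finite G" "G \<subseteq> \<Lambda>"
    "(LINT x|M. (norm (g x - (\<Sum>l\<in>G. d l * e2pi (l * x))))\<^sup>2) < \<epsilon> / 4" .
  define h where "h l = (if l \<in> F then c l else 0) + (if l \<in> G then d l else 0)" for l
  have h: "(\<Sum>l\<in>F \<union> G. h l * e2pi (l * x)) =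
     (\<Sum>l\<in>F. c l * e2pi (l * x)) + (\<Sum>l\<in>G. d l * e2pi (l * x))" for x
  proof -
    have "(\<Sum>l\<in>F \<union> G. h l * e2pi (l * x)) =
      (\<Sum>l\<in>F \<union> G. if l \<in> F then c l * e2pi (l * x) else 0) + (\<Sum>l\<in>F \<union> G. if l \<in> G then d l * e2pi (l * x) else 0)"
      unfolding sum.distrib[symmetric] by (intro sum.cong) (auto simp: h_def distrib_right)
    also have "\<dots> = (\<Sum>l\<in>(F \<union> G) \<inter> F. c l * e2pi (l * x)) + (\<Sum>l\<in>(F \<union> G) \<inter> G. d l * e2pi (l * x))"
      using F(1) G(1) by (simp only: sum.inter_restrict finite_Un)
    finally show ?thesis by (simp add: Int_absorb1)
  qed
  have split: "f x + g x - (\<Sum>l\<in>F \<union> G. h l * e2pi (l * x)) =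
    (f x - (\<Sum>l\<in>F. c l * e2pi (l * x))) + (g x - (\<Sum>l\<in>G. d l * e2pi (l * x)))" for x
    unfolding h by simp
  have "(LINT x|M. (norm (f x + g x - (\<Sum>l\<in>F \<union> G. h l * e2pi (l * x))))\<^sup>2) < \<epsilon>"
    unfolding split using integral_norm_add_squared_le[OF L2_functions_diff[OF L(1) L2_functions_trig_sum[OF F(1), of c]]
        L2_functions_diff[OF L(2) L2_functions_trig_sum[OF G(1), of d]]] F(3) G(3)
    by simp
  then show "\<exists>F c. finite F \<and> F \<subseteq> \<Lambda> \<and> (LINT x|M. (norm (f x + g x - (\<Sum>l\<in>F. c l * e2pi (l * x))))\<^sup>2) < \<epsilon>"
    using F G by (intro exI[of _ "F \<union> G"] exI[of _ h]) auto
qed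

lemma approximable_cmult:
  assumes f: "approximable \<Lambda> f"
  shows "approximable \<Lambda> (\<lambda>x. a * f x)"
  unfolding approximable_def
proof (intro conjI allI impI)
  show "(\<lambda>x. a * f x) \<in> L2_functions M" using f by (simp add: approximable_def L2_functions_cmult)
  fix \<epsilon> :: real assume "\<epsilon> > 0"
  then have "\<epsilon> / ((norm a)\<^sup>2 + 1) > 0" by (simp add: add_nonneg_pos)
  from approximableE[OF f this] obtain F c where F: "finite F" "F \<subseteq> \<Lambda>"
    "(LINT x|M. (norm (f x - (\<Sum>l\<in>F. c l * e2pi (l * x))))\<^sup>2) < \<epsilon> / ((norm a)\<^sup>2 + 1)" (is "?I < _") .
  have "(norm (a * f x - (\<Sum>l\<in>F. a * c l * e2pi (l * x))))\<^sup>2 =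
    (norm a)\<^sup>2 * (norm (f x - (\<Sum>l\<in>F. c l * e2pi (l * x))))\<^sup>2" for x
  proof -
    have "a * f x - (\<Sum>l\<in>F. a * c l * e2pi (l * x)) = a * (f x - (\<Sum>l\<in>F. c l * e2pi (l * x)))"
      by (simp add: right_diff_distrib sum_distrib_left mult.assoc)
    then show ?thesis by (simp add: norm_mult power_mult_distrib)
  qed
  then have "(LINT x|M. (norm (a * f x - (\<Sum>l\<in>F. a * c l * e2pi (l * x))))\<^sup>2) = (norm a)\<^sup>2 * ?I" by simp
  also have "\<dots> \<le> ((norm a)\<^sup>2 + 1) * ?I" by (intro mult_right_mono) auto
  also have "\<dots> < \<epsilon>" using F(3) by (simp add: pos_less_divide_eq add_nonneg_pos mult.commute)
  finally show "\<exists>F c. finite F \<and> F \<subseteq> \<Lambda> \<and> (LINT x|M. (norm (a * f x - (\<Sum>l\<in>F. c l * e2pi (l * x))))\<^sup>2) < \<epsilon>"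
    using F by (intro exI[of _ F] exI[of _ "\<lambda>l. a * c l"]) auto
qed

lemma approximable_dominated:
  assumes f: "f \<in> borel_measurable M" and g: "\<And>n. approximable \<Lambda> (g n)"
    and w: "integrable M w" "\<And>n x. (norm (g n x))\<^sup>2 \<le> w x"
    and lim: "\<And>x. (\<lambda>n. g n x) \<longlonglongrightarrow> f x"
  shows "approximable \<Lambda> f"
proof (rule approximable_limit)
  have [measurable]: "f \<in> borel_measurable M" "\<And>n. g n \<in> borel_measurable M"
    using f g by (auto simp: approximable_def L2_functions_def)
  have fw: "(norm (f x))\<^sup>2 \<le> w x" for x
    by (rule LIMSEQ_le_const2[OF tendsto_power[OF tendsto_norm[OF lim]]]) (use w(2) in auto)
  have w0: "w x \<ge> 0" for x using w(2)[of 0 x] by (meson order_trans zero_le_power2)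
  have "integrable M (\<lambda>x. (norm (f x))\<^sup>2)"
    by (rule Bochner_Integration.integrable_bound[OF w(1)]) (use fw w0 in auto)
  then show "f \<in> L2_functions M" using f by (simp add: L2_functions_def)
  have "(\<lambda>n. LINT x|M. (norm (f x - g n x))\<^sup>2) \<longlonglongrightarrow> (LINT x|M. 0)"
  proof (rule integral_dominated_convergence[where w = "\<lambda>x. 4 * w x"])
    show "AE x in M. (\<lambda>n. (norm (f x - g n x))\<^sup>2) \<longlonglongrightarrow> 0"
    proof (rule AE_I2)
      fix x
      have "(\<lambda>n. (norm (f x - g n x))\<^sup>2) \<longlonglongrightarrow> (norm (f x - f x))\<^sup>2" by (intro tendsto_intros lim)
      then show "(\<lambda>n. (norm (f x - g n x))\<^sup>2) \<longlonglongrightarrow> 0" by simp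
    qed
    show "AE x in M. norm ((norm (f x - g n x))\<^sup>2) \<le> 4 * w x" for n
    proof (rule AE_I2)
      fix x
      show "norm ((norm (f x - g n x))\<^sup>2) \<le> 4 * w x"
        using norm_add_squared_le[of "f x" "- g n x"] fw[of x] w(2)[of n x] by simp
    qed
  qed (use w(1) in auto)
  then have lim0: "(\<lambda>n. LINT x|M. (norm (f x - g n x))\<^sup>2) \<longlonglongrightarrow> 0" by simp
  fix \<epsilon> :: real assume "\<epsilon> > 0"
  from order_tendstoD(2)[OF lim0 this] obtain n where "(LINT x|M. (norm (f x - g n x))\<^sup>2) < \<epsilon>"
    by (meson eventually_sequentially order_refl)
  then show "\<exists>g. approximable \<Lambda> g \<and> (LINT x|M. (norm (f x - g x))\<^sup>2) < \<epsilon>" using g by blast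
qed

inductive_set trig_poly :: "(real \<Rightarrow> complex) set" where
  monomial: "(\<lambda>x. c * e2pi (l * x)) \<in> trig_poly"
| add: "f \<in> trig_poly \<Longrightarrow> g \<in> trig_poly \<Longrightarrow> (\<lambda>x. f x + g x) \<in> trig_poly"

lemma trig_poly_mult: "f \<in> trig_poly \<Longrightarrow> g \<in> trig_poly \<Longrightarrow> (\<lambda>x. f x * g x) \<in> trig_poly"
proof (induction f rule: trig_poly.induct)
  case (monomial c l)
  then show ?case
  proof (induction g rule: trig_poly.induct)
    case (monomial d m)
    have "(\<lambda>x. c * e2pi (l * x) * (d * e2pi (m * x))) = (\<lambda>x. (c * d) * e2pi ((l + m) * x))"
      by (simp add: distrib_right e2pi_add mult.assoc mult.left_commute)
    then show ?case by (simp only: trig_poly.monomial)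
  next
    case (add f g) then show ?case using trig_poly.add by (simp add: distrib_left)
  qed
next
  case (add f h) then show ?case using trig_poly.add by (simp add: distrib_right)
qed

lemma continuous_on_e2pi: "continuous_on UNIV e2pi"
  unfolding e2pi_def[abs_def] by (intro continuous_intros)

lemma trig_poly_continuous: "f \<in> trig_poly \<Longrightarrow> continuous_on S f"
proof (induction rule: trig_poly.induct)
  case (monomial c l)
  show ?case by (intro continuous_intros continuous_on_compose2[OF continuous_on_e2pi]) auto
qed (intro continuous_intros)

text \<open>Points \<open>x \<noteq> y\<close> are separated by the frequency \<open>s\<close> with \<open>s(x - y) = 1/2\<close>, for which \<open>e(sx) = -e(sy)\<close>.\<close>
lemma trig_poly_function_ring:
  "function_ring_on {g :: real \<Rightarrow> real. (\<lambda>x. of_real (g x)) \<in> trig_poly} {-K..K}"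
proof
  fix f :: "real \<Rightarrow> real" assume "f \<in> {g. (\<lambda>x. of_real (g x)) \<in> trig_poly}"
  then have "continuous_on {-K..K} (\<lambda>x. Re (of_real (f x)))"
    by (intro continuous_on_Re trig_poly_continuous) simp
  then show "continuous_on {-K..K} f" by simp
next
  fix f g :: "real \<Rightarrow> real"
  assume "f \<in> {g. (\<lambda>x. of_real (g x)) \<in> trig_poly}" "g \<in> {g. (\<lambda>x. of_real (g x)) \<in> trig_poly}"
  then show "(\<lambda>x. f x + g x) \<in> {g. (\<lambda>x. of_real (g x)) \<in> trig_poly}"
    "(\<lambda>x. f x * g x) \<in> {g. (\<lambda>x. of_real (g x)) \<in> trig_poly}"
    using trig_poly.add trig_poly_mult by auto
next
  fix c :: real
  show "(\<lambda>_. c) \<in> {g :: real \<Rightarrow> real. (\<lambda>x. of_real (g x)) \<in> trig_poly}"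
    using trig_poly.monomial[of "of_real c" 0] by simp
next
  fix x y :: real assume "x \<noteq> y"
  define s where "s = 1 / (2 * (x - y))"
  have re: "(\<lambda>t. of_real (Re (e2pi (s * t)))) \<in> trig_poly"
  proof -
    have "(\<lambda>t. of_real (Re (e2pi (s * t)))) = (\<lambda>t. (1/2) * e2pi (s * t) + (1/2) * e2pi ((- s) * t))"
      by (rule ext) (simp add: complex_eq_iff e2pi_def)
    then show ?thesis by (simp only: trig_poly.intros)
  qed
  have im: "(\<lambda>t. of_real (Im (e2pi (s * t)))) \<in> trig_poly"
  proof -
    have "(\<lambda>t. of_real (Im (e2pi (s * t)))) = (\<lambda>t. (- \<i>/2) * e2pi (s * t) + (\<i>/2) * e2pi ((- s) * t))"
      by (rule ext) (simp add: complex_eq_iff e2pi_def)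
    then show ?thesis by (simp only: trig_poly.intros)
  qed
  have "s * x = s * y + 1/2" using \<open>x \<noteq> y\<close> by (simp add: s_def field_simps)
  moreover have "e2pi (1/2) = -1" by (simp add: e2pi_def)
  ultimately have "e2pi (s * x) = - e2pi (s * y)" by (simp add: e2pi_add)
  then have "e2pi (s * x) \<noteq> e2pi (s * y)"
    using e2pi_nonzero[of "s * y"] by (auto simp: eq_neg_iff_add_eq_0 simp flip: mult_2)
  then have "Re (e2pi (s * x)) \<noteq> Re (e2pi (s * y)) \<or> Im (e2pi (s * x)) \<noteq> Im (e2pi (s * y))"
    by (simp add: complex_eq_iff)
  then show "\<exists>f\<in>{g :: real \<Rightarrow> real. (\<lambda>x. of_real (g x)) \<in> trig_poly}. f x \<noteq> f y"
  proof
    assume "Re (e2pi (s * x)) \<noteq> Re (e2pi (s * y))"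
    then show ?thesis using re by (intro bexI[of _ "\<lambda>t. Re (e2pi (s * t))"]) auto
  next
    assume "Im (e2pi (s * x)) \<noteq> Im (e2pi (s * y))"
    then show ?thesis using im by (intro bexI[of _ "\<lambda>t. Im (e2pi (s * t))"]) auto
  qed
qed simp

text \<open>If all exponentials lie in the closed span, then so does every square integrable function: the
  Stone-Weierstrass theorem yields bounded continuous functions, and pointwise limits yield half-lines, Borel sets
  (by a Dynkin argument), simple functions and finally all of \<open>L\<^sup>2\<close>.\<close>
context
  fixes \<Lambda> :: "real set"
  assumes exponentials: "\<And>l. approximable \<Lambda> (\<lambda>x. e2pi (l * x))"
begin

lemma approximable_trig_poly: "f \<in> trig_poly \<Longrightarrow> approximable \<Lambda> f"
  by (induction rule: trig_poly.induct) (auto intro: approximable_add approximable_cmult exponentials)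

lemma approximable_continuous:
  fixes g :: "real \<Rightarrow> real"
  assumes g: "continuous_on UNIV g" "\<And>x. \<bar>g x\<bar> \<le> C"
  shows "approximable \<Lambda> (\<lambda>x. of_real (g x))"
proof (rule approximable_limit)
  have [measurable]: "g \<in> borel_measurable borel" using g(1) by (rule borel_measurable_continuous_onI)
  show gL: "(\<lambda>x. complex_of_real (g x)) \<in> L2_functions M"
    by (rule L2_functions_bounded[of _ C]) (use g(2) in auto)
  fix \<epsilon> :: real assume "\<epsilon> > 0"
  define \<delta> where "\<delta> = sqrt (\<epsilon> / 2)"
  have \<delta>: "\<delta> > 0" "\<delta>\<^sup>2 = \<epsilon> / 2" using \<open>\<epsilon> > 0\<close> by (auto simp: \<delta>_def)
  from function_ring_on.Stone_Weierstrass_basic[OF trig_poly_function_ring continuous_on_subset[OF g(1)] \<delta>(1)]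
  obtain h where h: "(\<lambda>x. of_real (h x)) \<in> trig_poly" "\<And>x. \<bar>x\<bar> \<le> K \<Longrightarrow> \<bar>g x - h x\<bar> < \<delta>"
    by (auto simp: abs_le_iff minus_le_iff)
  have hA: "approximable \<Lambda> (\<lambda>x. of_real (h x))" using h(1) by (rule approximable_trig_poly)
  have "(LINT x|M. (norm (complex_of_real (g x) - of_real (h x)))\<^sup>2) \<le> (LINT x|M. \<delta>\<^sup>2)"
  proof (rule integral_mono_AE)
    show "integrable M (\<lambda>x. (norm (complex_of_real (g x) - of_real (h x)))\<^sup>2)"
      using L2_functions_diff[OF gL, of "\<lambda>x. of_real (h x)"] hA
      by (simp add: approximable_def L2_functions_def)
    show "AE x in M. (norm (complex_of_real (g x) - of_real (h x)))\<^sup>2 \<le> \<delta>\<^sup>2"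
      using bounded
    proof eventually_elim
      case (elim x)
      then have "norm (complex_of_real (g x) - of_real (h x)) \<le> \<delta>"
        using h(2)[of x] by (simp flip: of_real_diff)
      then show ?case by (intro power_mono) auto
    qed
  qed simp
  also have "\<dots> < \<epsilon>" using \<delta>(2) \<open>\<epsilon> > 0\<close> prob_space by (simp del: space_eq_univ)
  finally show "\<exists>h. approximable \<Lambda> h \<and> (LINT x|M. (norm (complex_of_real (g x) - h x))\<^sup>2) < \<epsilon>"
    using hA by blast
qed

lemma approximable_const: "approximable \<Lambda> (\<lambda>x. c)"
  using approximable_trig_poly[OF trig_poly.monomial[of c 0]] by simp

lemma approximable_half_line: "approximable \<Lambda> (indicator {..a})"
proof (rule approximable_dominated[where w = "\<lambda>_. 1"])
  define g where "g n x = max 0 (min 1 (1 - real n * (x - a)))" for n x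
  show "approximable \<Lambda> (\<lambda>x. of_real (g n x))" for n
    by (rule approximable_continuous[of _ 1]) (auto simp: g_def[abs_def] intro!: continuous_intros)
  show "(norm (complex_of_real (g n x)))\<^sup>2 \<le> 1" for n x
    by (simp add: g_def power_le_one)
  show "(\<lambda>n. complex_of_real (g n x)) \<longlonglongrightarrow> indicator {..a} x" for x
  proof (cases "x \<le> a")
    case True
    then have "g n x = 1" for n by (simp add: g_def mult_nonneg_nonpos)
    then show ?thesis using True by simp
  next
    case False
    then obtain n0 :: nat where n0: "1 < real n0 * (x - a)" using reals_Archimedean3[of "x - a"] by auto
    have "g n x = 0" if "n \<ge> n0" for n
    proof -
      have "real n0 * (x - a) \<le> real n * (x - a)" using that False by (intro mult_right_mono) auto
      then show ?thesis using n0 by (simp add: g_def)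
    qed
    then have "\<forall>\<^sub>F n in sequentially. complex_of_real (g n x) = indicator {..a} x"
      using False by (intro eventually_sequentiallyI[of n0]) simp
    then show ?thesis by (rule tendsto_eventually)
  qed
qed auto

lemma approximable_sum:
  "finite I \<Longrightarrow> (\<And>i. i \<in> I \<Longrightarrow> approximable \<Lambda> (f i)) \<Longrightarrow> approximable \<Lambda> (\<lambda>x. \<Sum>i\<in>I. f i x)"
  by (induction I rule: finite_induct) (auto intro: approximable_add approximable_const)

lemma approximable_indicator:
  assumes "A \<in> sets borel"
  shows "approximable \<Lambda> (indicator A)"
proof -
  have borel: "sets (borel :: real measure) = sigma_sets UNIV (range (\<lambda>a. {..a}))"
    by (subst borel_eq_atMost) simp
  have "Int_stable (range (\<lambda>a::real. {..a}))"
    by (auto simp: Int_stable_def intro!: range_eqI)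
  from this show ?thesis
  proof (rule sigma_sets_induct_disjoint)
    show "A \<in> sigma_sets UNIV (range (\<lambda>a. {..a}))" using assms borel by simp
    show "approximable \<Lambda> (indicator A)" if "A \<in> range (\<lambda>a. {..a})" for A
      using that approximable_half_line by auto
    show "approximable \<Lambda> (indicator {})" using approximable_const[of 0] by (simp add: indicator_def[abs_def])
    show "approximable \<Lambda> (indicator (UNIV - A))" if "approximable \<Lambda> (indicator A)" for A
    proof -
      have "indicator (UNIV - A) = (\<lambda>x. 1 + (- 1) * indicator A x :: complex)"
        by (rule ext) (simp add: indicator_def)
      then show ?thesis using that by (simp only: approximable_add approximable_cmult approximable_const)
    qed
    fix A :: "nat \<Rightarrow> real set"
    assume A: "disjoint_family A" "range A \<subseteq> sigma_sets UNIV (range (\<lambda>a. {..a}))"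
      "\<And>i. approximable \<Lambda> (indicator (A i))"
    have Ab [measurable]: "A i \<in> sets borel" for i using A(2) borel by auto
    have partial: "(\<Sum>i<n. indicator (A i) x :: complex) = indicator (\<Union>i<n. A i) x" for n x
      using A(1) by (intro indicator_UN_disjoint[symmetric]) (auto simp: disjoint_family_on_def)
    show "approximable \<Lambda> (indicator (\<Union>i. A i))"
    proof (rule approximable_dominated[where w = "\<lambda>_. 1"])
      show "approximable \<Lambda> (\<lambda>x. \<Sum>i<n. indicator (A i) x)" for n
        using A(3) by (intro approximable_sum) auto
      show "(norm (\<Sum>i<n. indicator (A i) x :: complex))\<^sup>2 \<le> 1" for n x
        unfolding partial by (simp add: indicator_def)
      show "(\<lambda>n. \<Sum>i<n. indicator (A i) x :: complex) \<longlonglongrightarrow> indicator (\<Union>i. A i) x" for x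
        unfolding partial by (rule LIMSEQ_indicator_UN)
    qed auto
  qed auto
qed

lemma approximable_L2:
  assumes f: "f \<in> L2_functions M"
  shows "approximable \<Lambda> f"
proof -
  have fm: "f \<in> borel_measurable M" and fi: "integrable M (\<lambda>x. (norm (f x))\<^sup>2)"
    using f by (auto simp: L2_functions_def)
  from borel_measurable_implies_sequence_metric[OF fm, of 0] obtain s where
    s: "\<And>i. simple_function M (s i)" "\<And>x. (\<lambda>i. s i x) \<longlonglongrightarrow> f x" "\<And>i x. norm (s i x) \<le> 2 * norm (f x)"
    by auto
  show ?thesis
  proof (rule approximable_dominated[OF fm, where w = "\<lambda>x. (2 * norm (f x))\<^sup>2"])
    show "approximable \<Lambda> (s i)" for i
    proof -
      have fin: "finite (range (s i))" using simple_functionD(1)[OF s(1)] by simp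
      have "s i = (\<lambda>x. \<Sum>y\<in>range (s i). y * indicator (s i -` {y}) x)"
      proof
        fix x
        have "(\<Sum>y\<in>range (s i). y * indicator (s i -` {y}) x) =
              (\<Sum>y\<in>range (s i). if s i x = y then y else 0)"
          by (intro sum.cong refl) (simp add: indicator_def)
        then show "s i x = (\<Sum>y\<in>range (s i). y * indicator (s i -` {y}) x)" using fin by simp
      qed
      moreover have "approximable \<Lambda> (\<lambda>x. \<Sum>y\<in>range (s i). y * indicator (s i -` {y}) x)"
        using simple_functionD(2)[OF s(1)]
        by (intro approximable_sum fin approximable_cmult approximable_indicator) simp
      ultimately show ?thesis by simp
    qed
    show "(norm (s n x))\<^sup>2 \<le> (2 * norm (f x))\<^sup>2" for n x by (intro power_mono s) simp
    show "integrable M (\<lambda>x. (2 * norm (f x))\<^sup>2)" using fi by (simp add: power_mult_distrib)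
  qed (rule s)
qed

end

lemma L2_inner_exponentials:
  "L2_inner M (\<lambda>x. e2pi (l * x)) (\<lambda>x. e2pi (m * x)) = ft M (l - m)"
  by (simp add: L2_inner_def e2pi_mult_cnj integral_e2pi flip: left_diff_distrib)

text \<open>Sufficiency in the criterion of Jorgensen and Pedersen. Since \<open>|\<mu>^(x - l)|\<close> is the modulus of the inner product of \<open>e(x\<cdot>)\<close>
  and \<open>e(l\<cdot>)\<close>, the hypothesis is Parseval's identity for \<open>e(x\<cdot>)\<close>. For \<open>x \<in> \<Lambda>\<close> the term \<open>l = x\<close> already
  contributes 1, so all other terms vanish, which is orthogonality. For general \<open>x\<close> it says that the
  projection error of \<open>e(x\<cdot>)\<close> tends to 0.\<close>
context
  fixes \<Lambda> :: "real set"
  assumes parseval: "\<And>x. ((\<lambda>l. (cmod (ft M (x - l)))\<^sup>2) has_sum 1) \<Lambda>"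
begin

lemma parseval_orthogonal:
  assumes "l \<in> \<Lambda>" "m \<in> \<Lambda>" "l \<noteq> m"
  shows "ft M (l - m) = 0"
proof -
  have "(\<Sum>k\<in>{l, m}. (cmod (ft M (l - k)))\<^sup>2) \<le> 1"
    using parseval[of l] assms by (intro finite_sum_le_has_sum[where A = \<Lambda>]) auto
  then show ?thesis using assms(3) ft_0 by simp
qed

lemma projection_error:
  assumes F: "finite F" "F \<subseteq> \<Lambda>"
  shows "(LINT t|M. (norm (e2pi (x * t) - (\<Sum>l\<in>F. ft M (x - l) * e2pi (l * t))))\<^sup>2) =
    1 - (\<Sum>l\<in>F. (cmod (ft M (x - l)))\<^sup>2)"
proof -
  define c where "c l = ft M (x - l)" for l
  have cnjc: "ft M (l - x) = cnj (c l)" for l using ft_uminus[of "x - l"] by (simp add: c_def)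
  have pw: "of_real ((norm (e2pi (x * t) - (\<Sum>l\<in>F. c l * e2pi (l * t))))\<^sup>2) =
     1 - (\<Sum>l\<in>F. cnj (c l) * e2pi ((x - l) * t)) - (\<Sum>l\<in>F. c l * e2pi ((l - x) * t))
     + (\<Sum>l\<in>F. \<Sum>m\<in>F. c l * cnj (c m) * e2pi ((l - m) * t))" for t
  proof -
    define P where "P = (\<Sum>l\<in>F. c l * e2pi (l * t))"
    have e: "e2pi (a * t) * cnj (e2pi (b * t)) = e2pi ((a - b) * t)" for a b
      by (simp add: e2pi_mult_cnj left_diff_distrib)
    have "of_real ((norm (e2pi (x * t) - P))\<^sup>2) =
      e2pi (x * t) * cnj (e2pi (x * t)) - e2pi (x * t) * cnj P - P * cnj (e2pi (x * t)) + P * cnj P"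
      unfolding complex_norm_square by (simp add: algebra_simps)
    also have "e2pi (x * t) * cnj (e2pi (x * t)) = 1" by (simp add: e2pi_mult_cnj)
    also have "e2pi (x * t) * cnj P = (\<Sum>l\<in>F. cnj (c l) * e2pi ((x - l) * t))"
      unfolding P_def e[symmetric] by (simp add: sum_distrib_left mult_ac)
    also have "P * cnj (e2pi (x * t)) = (\<Sum>l\<in>F. c l * e2pi ((l - x) * t))"
      unfolding P_def e[symmetric] sum_distrib_right by (simp only: mult.assoc)
    also have "P * cnj P = (\<Sum>l\<in>F. \<Sum>m\<in>F. c l * cnj (c m) * e2pi ((l - m) * t))"
      unfolding P_def e[symmetric] by (simp add: sum_product mult_ac)
    finally show ?thesis unfolding P_def .
  qed
  have "of_real (LINT t|M. (norm (e2pi (x * t) - (\<Sum>l\<in>F. c l * e2pi (l * t))))\<^sup>2) =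
    (LINT t|M. of_real ((norm (e2pi (x * t) - (\<Sum>l\<in>F. c l * e2pi (l * t))))\<^sup>2) :: complex)"
    by (rule integral_complex_of_real[symmetric])
  also have "\<dots> = 1 - (\<Sum>l\<in>F. cnj (c l) * ft M (x - l)) - (\<Sum>l\<in>F. c l * ft M (l - x))
     + (\<Sum>l\<in>F. \<Sum>m\<in>F. c l * cnj (c m) * ft M (l - m))"
    unfolding pw using prob_space
    by (simp add: integrable_e2pi integral_e2pi Bochner_Integration.integral_sum
        Bochner_Integration.integrable_sum del: space_eq_univ)
  also have "(\<Sum>l\<in>F. \<Sum>m\<in>F. c l * cnj (c m) * ft M (l - m)) = (\<Sum>l\<in>F. c l * cnj (c l))"
  proof (rule sum.cong)
    fix l assume l: "l \<in> F"
    have "(\<Sum>m\<in>F. c l * cnj (c m) * ft M (l - m)) = (\<Sum>m\<in>F. if m = l then c l * cnj (c l) else 0)"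
      using l F parseval_orthogonal ft_0 by (intro sum.cong) auto
    then show "(\<Sum>m\<in>F. c l * cnj (c m) * ft M (l - m)) = c l * cnj (c l)" using l F by simp
  qed simp
  also have "1 - (\<Sum>l\<in>F. cnj (c l) * ft M (x - l)) - (\<Sum>l\<in>F. c l * ft M (l - x)) + (\<Sum>l\<in>F. c l * cnj (c l))
    = 1 - (\<Sum>l\<in>F. c l * cnj (c l))"
    unfolding cnjc c_def[symmetric] by (simp add: mult_ac)
  also have "\<dots> = of_real (1 - (\<Sum>l\<in>F. (cmod (c l))\<^sup>2))"
    by (simp add: complex_norm_square[symmetric] del: of_real_power)
  finally show ?thesis unfolding of_real_eq_iff c_def .
qed

lemma spectrum_if_parseval: "is_spectrum M \<Lambda>"
proof -
  have appr: "approximable \<Lambda> (\<lambda>t. e2pi (x * t))" for x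
    unfolding approximable_def
  proof (intro conjI allI impI)
    show "(\<lambda>t. e2pi (x * t)) \<in> L2_functions M" by (rule L2_functions_bounded[of _ 1]) auto
    fix \<epsilon> :: real assume "\<epsilon> > 0"
    from parseval[of x] have "(sum (\<lambda>l. (cmod (ft M (x - l)))\<^sup>2) \<longlongrightarrow> 1) (finite_subsets_at_top \<Lambda>)"
      by (simp add: has_sum_def)
    from order_tendstoD(1)[OF this, of "1 - \<epsilon>"] \<open>\<epsilon> > 0\<close> obtain F where
      "finite F" "F \<subseteq> \<Lambda>" "1 - \<epsilon> < (\<Sum>l\<in>F. (cmod (ft M (x - l)))\<^sup>2)"
      unfolding eventually_finite_subsets_at_top by auto
    then show "\<exists>F c. finite F \<and> F \<subseteq> \<Lambda> \<and>
       (LINT t|M. (norm (e2pi (x * t) - (\<Sum>l\<in>F. c l * e2pi (l * t))))\<^sup>2) < \<epsilon>"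
      using projection_error[of F x] by (intro exI[of _ F] exI[of _ "\<lambda>l. ft M (x - l)"]) auto
  qed
  have e: "(\<lambda>l x. exp (2 * of_real pi * \<i> * of_real (l * x))) = (\<lambda>l x. e2pi (l * x))"
    by (simp add: fun_eq_iff e2pi_def cis_conv_exp mult_ac)
  show ?thesis
    unfolding is_spectrum_def L2_orthonormal_basis_def e
  proof (intro conjI ballI allI impI)
    fix l show "(\<lambda>x. e2pi (l * x)) \<in> L2_functions M" by (rule L2_functions_bounded[of _ 1]) auto
  next
    fix l m assume "l \<in> \<Lambda>" "m \<in> \<Lambda>"
    then show "L2_inner M (\<lambda>x. e2pi (l * x)) (\<lambda>x. e2pi (m * x)) = (if l = m then 1 else 0)"
      using parseval_orthogonal ft_0 by (simp add: L2_inner_exponentials)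
  next
    fix f and \<epsilon> :: real assume "f \<in> L2_functions M" "\<epsilon> > 0"
    then have "approximable \<Lambda> f" "\<epsilon>\<^sup>2 > 0" using approximable_L2[OF appr] by auto
    from approximableE[OF this] obtain F c where F: "finite F" "F \<subseteq> \<Lambda>"
       "(LINT x|M. (norm (f x - (\<Sum>l\<in>F. c l * e2pi (l * x))))\<^sup>2) < \<epsilon>\<^sup>2" .
    from F(3) have "L2_norm M (\<lambda>x. f x - (\<Sum>l\<in>F. c l * e2pi (l * x))) < \<epsilon>"
      unfolding L2_norm_def using \<open>\<epsilon> > 0\<close> by (intro real_less_lsqrt) auto
    then show "\<exists>F c. finite F \<and> F \<subseteq> \<Lambda> \<and> L2_norm M (\<lambda>x. f x - (\<Sum>l\<in>F. c l * e2pi (l * x))) < \<epsilon>"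
      using F by blast
  qed
qed

end
end

section \<open>Zeros of the Fourier transform\<close>

lemma finite_e2pi_fibre: "finite {x. a \<le> x \<and> x \<le> b \<and> e2pi x = w}"
proof (cases "\<exists>x0. e2pi x0 = w")
  case True
  then obtain x0 where x0: "e2pi x0 = w" by blast
  have "{x. a \<le> x \<and> x \<le> b \<and> e2pi x = w} \<subseteq> (\<lambda>k::int. x0 + of_int k) ` {\<lfloor>a - x0\<rfloor>..\<lceil>b - x0\<rceil>}"
  proof clarify
    fix x assume x: "a \<le> x" "x \<le> b" "w = e2pi x"
    have "e2pi (x - x0) = 1"
      using x0 x(3) by (simp add: e2pi_mult_cnj[symmetric]) (simp add: e2pi_mult_cnj)
    then obtain k :: int where "x - x0 = of_int k" using e2pi_eq_1D by blast
    then show "x \<in> (\<lambda>k::int. x0 + of_int k) ` {\<lfloor>a - x0\<rfloor>..\<lceil>b - x0\<rceil>}"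
      using x by (intro image_eqI[of _ _ k]) (auto simp: floor_le_iff le_ceiling_iff)
  qed
  then show ?thesis by (rule finite_subset) simp
qed simp

context digit_system
begin

text \<open>Up to a factor without zeros, \<open>m(x)\<close> is a nonzero polynomial in \<open>e(x)\<close>.\<close>
lemma finite_zeros_mask: "finite {x. a \<le> x \<and> x \<le> b \<and> mask x = 0}"
proof -
  \<comment> \<open>The shift by \<open>K\<close> makes all exponents nonnegative.\<close>
  define K where "K = Max (abs ` B)"
  have K: "0 \<le> c + K" if "c \<in> B" for c
  proof -
    have "\<bar>c\<bar> \<le> K" unfolding K_def using finite_B that by auto
    then show ?thesis by linarith
  qed
  define P :: "complex poly" where "P = (\<Sum>c\<in>B. monom 1 (nat (c + K)))"
  obtain c0 where c0: "c0 \<in> B" using B_nonempty by blast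
  have "coeff P (nat (c0 + K)) = (\<Sum>c\<in>B. if c = c0 then 1 else 0)"
    unfolding P_def coeff_sum using K c0 by (intro sum.cong refl) (auto simp: nat_eq_iff)
  also have "\<dots> = 1" using c0 finite_B by simp
  finally have "P \<noteq> 0" by auto
  then have fin: "finite {w. poly P w = 0}" by (rule poly_roots_finite)
  have root: "poly P (e2pi x) = 0" if "mask x = 0" for x
  proof -
    have "poly P (e2pi x) = (\<Sum>c\<in>B. e2pi (of_int c * x) * e2pi (of_int K * x))"
      unfolding P_def poly_sum poly_monom e2pi_power using K
      by (intro sum.cong refl) (simp add: distrib_right flip: e2pi_add)
    also have "\<dots> = 0" using that card_B_pos unfolding sum_distrib_right[symmetric] mask_def by simp
    finally show ?thesis .
  qed
  have "{x. a \<le> x \<and> x \<le> b \<and> mask x = 0} \<subseteq>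
    (\<Union>w\<in>{w. poly P w = 0}. {x. a \<le> x \<and> x \<le> b \<and> e2pi x = w})"
    using root by auto
  then show ?thesis by (rule finite_subset) (intro finite_UN_I fin finite_e2pi_fibre)
qed

abbreviation muhat :: "real \<Rightarrow> complex" where
  "muhat \<equiv> ft (self_similar_measure N B)"

lemmas muhat_self_similar = ft_self_similar[OF is_self_similar_self_similar_measure]
  and muhat_eq_mask_prod = ft_eq_mask_prod[OF is_self_similar_self_similar_measure]
  and mask_prod_tendsto_muhat = mask_prod_tendsto_ft[OF is_self_similar_self_similar_measure]
  and real_distribution_self_similar_measure =
    self_similar_real_distribution[OF is_self_similar_self_similar_measure]

lemma muhat_0: "muhat 0 = 1"
  using real_distribution.char_zero[OF real_distribution_self_similar_measure] by simp

lemma norm_muhat_le_1: "norm (muhat x) \<le> 1"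
  by (rule real_distribution.cmod_char_le_1[OF real_distribution_self_similar_measure])

lemma muhat_tendsto:
  "(f \<longlongrightarrow> x) F \<Longrightarrow> ((\<lambda>n. muhat (f n)) \<longlongrightarrow> muhat x) F"
  by (rule isCont_tendsto_compose[OF real_distribution.isCont_char[OF real_distribution_self_similar_measure]])
     (intro tendsto_intros)

lemma muhat_large_near_0: "\<exists>d>0. \<forall>x. \<bar>x\<bar> \<le> d \<longrightarrow> norm (muhat x) \<ge> 1/2"
proof -
  have "((\<lambda>x. norm (muhat x)) \<longlongrightarrow> norm (muhat 0)) (at 0)"
    by (intro tendsto_norm muhat_tendsto tendsto_ident_at)
  then have "\<forall>\<^sub>F x in at 0. norm (muhat x) > 1/2"
    by (rule order_tendstoD(1)) (simp only: muhat_0, simp)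
  then obtain d where d: "d > 0" "\<And>x. x \<noteq> 0 \<Longrightarrow> \<bar>x\<bar> < d \<Longrightarrow> norm (muhat x) > 1/2"
    unfolding eventually_at by (auto simp: dist_real_def)
  have "norm (muhat x) \<ge> 1/2" if "\<bar>x\<bar> \<le> d/2" for x
    using d(1) d(2)[of x] that muhat_0 by (cases "x = 0") auto
  then show ?thesis using d(1) by (intro exI[of _ "d/2"]) auto
qed

text \<open>If \<open>\<mu>^\<close> vanishes at \<open>x\<close> but not near 0, then one of finitely many factors \<open>m(x/N\<^sup>j)\<close> vanishes.\<close>
lemma finite_zeros_muhat: "finite {x. \<bar>x\<bar> \<le> R \<and> muhat x = 0}"
proof -
  obtain d where d: "d > 0" "\<And>x. \<bar>x\<bar> \<le> d \<Longrightarrow> norm (muhat x) \<ge> 1/2"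
    using muhat_large_near_0 by blast
  obtain n where n: "R / real N ^ n < d"
    using order_tendstoD(2)[OF scaled_tendsto_0[of R] d(1)] by (auto simp: eventually_sequentially)
  have step: "\<exists>j\<in>{1..n}. mask (x / real N ^ j) = 0" if "\<bar>x\<bar> \<le> R" "muhat x = 0" for x
  proof -
    have "\<bar>x / real N ^ n\<bar> \<le> R / real N ^ n" using that(1) N_pos by (simp add: divide_right_mono)
    then have "muhat (x / real N ^ n) \<noteq> 0" using d(2)[of "x / real N ^ n"] n by auto
    then have "mask_prod n x = 0" using muhat_eq_mask_prod[of x n] that(2) by simp
    moreover have "mask_prod m x = 0 \<Longrightarrow> \<exists>j\<in>{1..m}. mask (x / real N ^ j) = 0" for m
    proof (induction m)
      case (Suc m)
      then have "mask_prod m x = 0 \<or> mask (x / real N ^ Suc m) = 0" by simp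
      then show ?case
      proof
        assume "mask_prod m x = 0"
        then show ?thesis using Suc.IH by (meson atLeastAtMost_iff le_SucI)
      next
        assume "mask (x / real N ^ Suc m) = 0"
        then show ?thesis by (intro bexI[of _ "Suc m"]) auto
      qed
    qed simp
    ultimately show ?thesis by blast
  qed
  have "{x. \<bar>x\<bar> \<le> R \<and> muhat x = 0} \<subseteq>
    (\<Union>j\<in>{1..n}. (\<lambda>y. real N ^ j * y) ` {y. -R \<le> y \<and> y \<le> R \<and> mask y = 0})"
  proof clarify
    fix x assume x: "\<bar>x\<bar> \<le> R" "muhat x = 0"
    then obtain j where j: "j \<in> {1..n}" "mask (x / real N ^ j) = 0" using step by blast
    have "\<bar>x / real N ^ j\<bar> \<le> \<bar>x\<bar>"
      using N_pos by (simp add: divide_le_eq) (simp add: mult_le_cancel_left1)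
    then have "- R \<le> x / real N ^ j" "x / real N ^ j \<le> R" using x(1) by linarith+
    then have "x / real N ^ j \<in> {y. -R \<le> y \<and> y \<le> R \<and> mask y = 0}" using x j by auto
    then show "x \<in> (\<Union>j\<in>{1..n}. (\<lambda>y. real N ^ j * y) ` {y. -R \<le> y \<and> y \<le> R \<and> mask y = 0})"
      using j(1) N_pos by (intro UN_I[of j] image_eqI[of _ _ "x / real N ^ j"]) auto
  qed
  then show ?thesis by (rule finite_subset) (intro finite_UN_I finite_imageI finite_zeros_mask, simp)
qed

end

context hadamard_system
begin

text \<open>The \<open>N\<close> squares sum to \<open>N/#B > 1\<close> while each is at most 1, so at least two of them are nonzero.\<close>
lemma two_nonvanishing_branches:
  assumes p: "coprime p N"
  shows "card {r. r < N \<and> mask (x + real p * real r / real N) \<noteq> 0} \<ge> 2"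
proof (rule ccontr)
  define R where "R = {r. r < N \<and> mask (x + real p * real r / real N) \<noteq> 0}"
  assume "\<not> card R \<ge> 2"
  then have "card R \<le> 1" by simp
  have "real N / real (card B) = (\<Sum>r<N. (cmod (mask (x + real p * real r / real N)))\<^sup>2)"
    using mask_frame_residues[OF p] by simp
  also have "\<dots> = (\<Sum>r\<in>R. (cmod (mask (x + real p * real r / real N)))\<^sup>2)"
    by (rule sum.mono_neutral_right) (auto simp: R_def)
  also have "\<dots> \<le> (\<Sum>r\<in>R. 1)" by (intro sum_mono power_le_one norm_mask_le_1) simp
  also have "\<dots> \<le> 1" using \<open>card R \<le> 1\<close> by simp
  finally show False using card_less card_B_pos by (simp add: divide_le_eq)
qed

text \<open>Let \<open>Z\<close> be the set of all \<open>x\<close> for which \<open>\<mu>^(p(x+k)) = 0\<close> for all \<open>k\<close>. It is invariant under integer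
  translations and finite modulo 1. If \<open>x \<in> Z\<close>, then \<open>(x+r)/N \<in> Z\<close> for each \<open>r\<close> with \<open>m(p(x+r)/N) \<noteq> 0\<close>, and there
  are at least two such \<open>r\<close>. As the points obtained are pairwise different, a fundamental domain \<open>Z1\<close> of \<open>Z\<close>
  satisfies \<open>2 #Z1 \<le> #Z1\<close> and is empty.\<close>
lemma translate_nonvanishing:
  assumes p: "coprime p N" "p > 0"
  shows "\<exists>k::int. muhat (real p * (x + of_int k)) \<noteq> 0"
proof -
  define Z where "Z = {x. \<forall>k::int. muhat (real p * (x + of_int k)) = 0}"
  define Z1 where "Z1 = Z \<inter> {0..<1}"
  have Z_int: "x + of_int j \<in> Z" if "x \<in> Z" for x and j :: int
  proof -
    have "muhat (real p * (x + of_int j + of_int k)) = 0" for k :: int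
      using that unfolding Z_def by (metis (mono_tags, lifting) mem_Collect_eq add.assoc of_int_add)
    then show ?thesis by (simp add: Z_def)
  qed
  have "Z1 \<subseteq> (\<lambda>y. y / real p) ` {y. \<bar>y\<bar> \<le> real p \<and> muhat y = 0}"
  proof
    fix x assume x: "x \<in> Z1"
    then have "muhat (real p * (x + of_int 0)) = 0" unfolding Z1_def Z_def by blast
    then have "real p * x \<in> {y. \<bar>y\<bar> \<le> real p \<and> muhat y = 0}"
      using x by (auto simp: Z1_def abs_mult mult_left_le)
    then show "x \<in> (\<lambda>y. y / real p) ` {y. \<bar>y\<bar> \<le> real p \<and> muhat y = 0}"
      using p(2) by (intro image_eqI[of _ _ "real p * x"]) auto
  qed
  then have fin: "finite Z1" by (rule finite_subset) (intro finite_imageI finite_zeros_muhat)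
  define R where "R x = {r. r < N \<and> mask (real p * x / real N + real p * real r / real N) \<noteq> 0}" for x
  have R2: "card (R x) \<ge> 2" for x unfolding R_def by (rule two_nonvanishing_branches[OF p(1)])
  have finR: "finite (R x)" for x unfolding R_def by simp
  have branch: "(x + real r) / real N \<in> Z1" if x: "x \<in> Z1" and r: "r \<in> R x" for x r
  proof -
    have "muhat (real p * ((x + real r) / real N + of_int k)) = 0" for k :: int
    proof -
      have eq: "real p * (x + of_int (int r + int N * k)) / real N =
        real p * ((x + real r) / real N + of_int k)"
        using N_pos by (simp add: field_simps)
      have "muhat (real p * (x + of_int (int r + int N * k))) = 0"
        using x unfolding Z1_def Z_def by blast
      then have "mask (real p * ((x + real r) / real N + of_int k)) *
        muhat (real p * ((x + real r) / real N + of_int k)) = 0"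
        by (subst (asm) muhat_self_similar) (simp only: eq)
      moreover have "mask (real p * ((x + real r) / real N + of_int k)) =
        mask (real p * x / real N + real p * real r / real N)"
      proof (rule mask_diff_int)
        have "real p * ((x + real r) / real N + of_int k) - (real p * x / real N + real p * real r / real N) =
          of_int (int p * k)"
          using N_pos by (simp add: field_simps)
        then show "real p * ((x + real r) / real N + of_int k) - (real p * x / real N + real p * real r / real N) \<in> \<int>"
          by (simp only: Ints_of_int)
      qed
      ultimately show ?thesis using r by (simp add: R_def)
    qed
    then have "(x + real r) / real N \<in> Z" by (simp add: Z_def)
    moreover have "x + real r < real N"
    proof -
      have "real r + 1 \<le> real N" using r by (simp add: R_def flip: of_nat_Suc)
      then show ?thesis using x by (simp add: Z1_def)
    qed
    ultimately show ?thesis using x N_pos by (simp add: Z1_def)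
  qed
  have inj: "inj_on (\<lambda>(x, r). (x + real r) / real N) (Sigma Z1 R)"
  proof (rule inj_onI, clarify)
    fix x r x' r' assume *: "x \<in> Z1" "x' \<in> Z1" "(x + real r) / real N = (x' + real r') / real N"
    then have eq: "x + real r = x' + real r'" using N_pos by simp
    have "\<bar>real r - real r'\<bar> < 1" using eq *(1,2) by (auto simp: Z1_def)
    then have "r = r'" by linarith
    then show "x = x' \<and> r = r'" using eq by simp
  qed
  have "2 * card Z1 = (\<Sum>x\<in>Z1. 2)" by simp
  also have "\<dots> \<le> (\<Sum>x\<in>Z1. card (R x))" by (intro sum_mono R2)
  also have "\<dots> = card (Sigma Z1 R)" using fin finR by simp
  also have "\<dots> \<le> card Z1"
    using branch by (intro card_inj_on_le[OF inj _ fin]) auto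
  finally have "Z1 = {}" using fin by simp
  have "x \<notin> Z"
  proof
    assume "x \<in> Z"
    from Z_int[OF this, of "- \<lfloor>x\<rfloor>"] have "frac x \<in> Z" by (simp add: frac_def)
    then have "frac x \<in> Z1" by (simp add: Z1_def frac_ge_0 frac_lt_1)
    then show False using \<open>Z1 = {}\<close> by simp
  qed
  then show ?thesis by (simp add: Z_def)
qed

lemma uniform_translate_bound:
  assumes p: "coprime p N" "p > 0"
  shows "\<exists>\<epsilon>>0. \<exists>\<delta>>0. \<forall>x. \<exists>k::int. \<forall>y. \<bar>y\<bar> \<le> \<delta> \<longrightarrow> \<epsilon> \<le> norm (muhat (real p * (x + of_int k) + y))"
proof (rule ccontr)
  assume "\<not> ?thesis"
  then have neg: "\<exists>x. \<forall>k::int. \<exists>y. \<bar>y\<bar> \<le> \<delta> \<and> norm (muhat (real p * (x + of_int k) + y)) < \<epsilon>"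
    if "\<epsilon> > 0" "\<delta> > 0" for \<epsilon> \<delta>
    using that by (meson not_le)
  define \<eta> where "\<eta> n = 1 / real (Suc n)" for n
  have \<eta>: "\<eta> n > 0" for n by (simp add: \<eta>_def)
  have "\<exists>x\<in>{0..1}. \<forall>k::int. \<exists>y. \<bar>y\<bar> \<le> \<eta> n \<and> norm (muhat (real p * (x + of_int k) + y)) < \<eta> n" for n
  proof -
    obtain x where x: "\<And>k::int. \<exists>y. \<bar>y\<bar> \<le> \<eta> n \<and> norm (muhat (real p * (x + of_int k) + y)) < \<eta> n"
      using neg[OF \<eta> \<eta>] by blast
    have "\<exists>y. \<bar>y\<bar> \<le> \<eta> n \<and> norm (muhat (real p * (frac x + of_int k) + y)) < \<eta> n" for k :: int
      using x[of "k - \<lfloor>x\<rfloor>"] by (simp add: frac_def algebra_simps)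
    then show ?thesis by (intro bexI[of _ "frac x"]) (auto simp: frac_ge_0 frac_lt_1 less_imp_le)
  qed
  then obtain X where X: "\<And>n. X n \<in> {0..1::real}"
    "\<And>n (k::int). \<exists>y. \<bar>y\<bar> \<le> \<eta> n \<and> norm (muhat (real p * (X n + of_int k) + y)) < \<eta> n"
    by metis
  have "compact {0..1::real}" by simp
  then obtain x r where r: "strict_mono r" "(X \<circ> r) \<longlonglongrightarrow> x"
    unfolding compact_def using X(1) by metis
  obtain k :: int where k: "muhat (real p * (x + of_int k)) \<noteq> 0"
    using translate_nonvanishing[OF p] by blast
  obtain Y where Y: "\<And>n. \<bar>Y n\<bar> \<le> \<eta> n" "\<And>n. norm (muhat (real p * (X n + of_int k) + Y n)) < \<eta> n"
    using X(2)[of _ k] by metis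
  have \<eta>0: "\<eta> \<longlonglongrightarrow> 0" unfolding \<eta>_def by (rule LIMSEQ_Suc[OF lim_1_over_n])
  then have \<eta>r: "(\<lambda>n. \<eta> (r n)) \<longlonglongrightarrow> 0"
    using LIMSEQ_subseq_LIMSEQ[OF _ r(1)] by (fastforce simp: o_def)
  have "(\<lambda>n. Y (r n)) \<longlonglongrightarrow> 0"
    by (rule Lim_null_comparison[OF _ \<eta>r]) (use Y(1) in auto)
  then have "(\<lambda>n. real p * ((X \<circ> r) n + of_int k) + Y (r n)) \<longlonglongrightarrow> real p * (x + of_int k) + 0"
    by (intro tendsto_intros r(2))
  then have "(\<lambda>n. norm (muhat (real p * ((X \<circ> r) n + of_int k) + Y (r n)))) \<longlonglongrightarrow>
    norm (muhat (real p * (x + of_int k) + 0))"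
    by (intro tendsto_norm muhat_tendsto)
  moreover have "(\<lambda>n. norm (muhat (real p * ((X \<circ> r) n + of_int k) + Y (r n)))) \<longlonglongrightarrow> 0"
    by (rule Lim_null_comparison[OF _ \<eta>r]) (use Y(2) in \<open>auto simp: less_imp_le\<close>)
  ultimately show False using LIMSEQ_unique k by fastforce
qed

text \<open>The second conjunct serves frequencies that are retained from earlier stages: after division by a
  high power of \<open>N\<close> they lie near 0 and need not be translated.\<close>
lemma uniform_lower_bound:
  assumes p: "coprime p N" "p > 0"
  shows "\<exists>\<epsilon>>0. \<exists>\<delta>>0.
    (\<forall>x. \<exists>k::int. \<forall>y. \<bar>y\<bar> \<le> \<delta> \<longrightarrow> \<epsilon> \<le> norm (muhat (real p * (x + of_int k) + y))) \<and>
    (\<forall>z. \<bar>z\<bar> \<le> 2 * \<delta> \<longrightarrow> \<epsilon> \<le> norm (muhat z))"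
proof -
  obtain \<epsilon> \<delta> where e: "\<epsilon> > 0" "\<delta> > 0"
    "\<And>x. \<exists>k::int. \<forall>y. \<bar>y\<bar> \<le> \<delta> \<longrightarrow> \<epsilon> \<le> norm (muhat (real p * (x + of_int k) + y))"
    using uniform_translate_bound[OF p] by blast
  obtain d where d: "d > 0" "\<And>x. \<bar>x\<bar> \<le> d \<Longrightarrow> norm (muhat x) \<ge> 1/2"
    using muhat_large_near_0 by blast
  have "\<exists>k::int. \<forall>y. \<bar>y\<bar> \<le> min \<delta> (d/2) \<longrightarrow> min \<epsilon> (1/2) \<le> norm (muhat (real p * (x + of_int k) + y))" for x
    using e(3)[of x] by (meson min.bounded_iff min.coboundedI1)
  moreover have "min \<epsilon> (1/2) \<le> norm (muhat z)" if "\<bar>z\<bar> \<le> 2 * min \<delta> (d/2)" for z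
    using d(2)[of z] that by (simp add: min_le_iff_disj)
  ultimately show ?thesis using e d
    by (intro exI[of _ "min \<epsilon> (1/2)"] conjI exI[of _ "min \<delta> (d/2)"]) auto
qed

end

section \<open>A universal spectrum\<close>

context hadamard_system
begin

text \<open>Finite approximations of the spectrum, for all dilations \<open>p\<close> simultaneously: the sum condition
  says that \<open>p\<Lambda>\<close> is a spectrum of the measure with Fourier transform \<open>M\<^sub>n\<close>, which is uniform on
  \<open>B/N + \<dots> + B/N\<^sup>n\<close>.\<close>
definition level_spectrum :: "nat \<Rightarrow> int set \<Rightarrow> bool" where
  "level_spectrum n \<Lambda> \<longleftrightarrow> finite \<Lambda> \<and> 0 \<in> \<Lambda> \<and>
     (\<forall>p x. coprime p N \<longrightarrow> (\<Sum>l\<in>\<Lambda>. (cmod (mask_prod n (x + real p * of_int l)))\<^sup>2) = 1)"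

lemma level_spectrum_0: "level_spectrum 0 {0}"
  by (simp add: level_spectrum_def)

text \<open>Two different elements congruent modulo \<open>N\<^sup>n\<close> would contribute \<open>1 + 1\<close> to a sum with value 1.\<close>
lemma level_spectrum_distinct_mod:
  assumes \<Lambda>: "level_spectrum n \<Lambda>" and l: "l \<in> \<Lambda>" "l' \<in> \<Lambda>" "l = l' + int N ^ n * k"
  shows "l = l'"
proof (rule ccontr)
  assume "l \<noteq> l'"
  have 1: "mask_prod n (- of_int l' + real 1 * of_int l) = 1"
    using mask_prod_add_int[of n 0 k] l(3) by simp
  have 2: "mask_prod n (- of_int l' + real 1 * of_int l') = 1" by simp
  have "2 = (\<Sum>i\<in>{l, l'}. (cmod (mask_prod n (- of_int l' + real 1 * of_int i)))\<^sup>2)"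
    using \<open>l \<noteq> l'\<close> 1 2 by (subst sum.insert) (simp_all only: sum.insert, auto)
  also have "\<dots> \<le> (\<Sum>i\<in>\<Lambda>. (cmod (mask_prod n (- of_int l' + real 1 * of_int i)))\<^sup>2)"
    using \<Lambda> l by (intro sum_mono2) (auto simp: level_spectrum_def)
  also have "\<dots> = 1"
    using \<Lambda> unfolding level_spectrum_def by (metis coprime_1_left)
  finally show False by simp
qed

text \<open>Adding the digits \<open>N\<^sup>n L\<close>: the factor \<open>M\<^sub>n\<close> does not see the new digit, and the new factor sums to 1 over
  \<open>L\<close> by \<open>mask_frame_L\<close>.\<close>
lemma level_spectrum_Suc:
  assumes \<Lambda>: "level_spectrum n \<Lambda>"
  shows "\<exists>\<Lambda>'. level_spectrum (Suc n) \<Lambda>' \<and> \<Lambda> \<subseteq> \<Lambda>'"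
proof (intro exI conjI)
  define g where "g = (\<lambda>(l, d). l + int N ^ n * d)"
  have inj: "inj_on g (\<Lambda> \<times> L)"
  proof (rule inj_onI, clarify)
    fix l d l' d' assume *: "l \<in> \<Lambda>" "l' \<in> \<Lambda>" "g (l, d) = g (l', d')"
    then have "l = l' + int N ^ n * (d' - d)" by (simp add: g_def right_diff_distrib)
    then have "l = l'" using level_spectrum_distinct_mod[OF \<Lambda>] * by blast
    then show "l = l' \<and> d = d'" using * N_pos by (simp add: g_def)
  qed
  show "\<Lambda> \<subseteq> g ` (\<Lambda> \<times> L)"
    using zero_in_L by (auto simp: g_def intro!: image_eqI[of _ _ "(_, 0)"])
  show "level_spectrum (Suc n) (g ` (\<Lambda> \<times> L))"
    unfolding level_spectrum_def
  proof (intro conjI allI impI)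
    show "finite (g ` (\<Lambda> \<times> L))" using \<Lambda> finite_L by (simp add: level_spectrum_def)
    show "0 \<in> g ` (\<Lambda> \<times> L)"
      using \<Lambda> zero_in_L by (intro image_eqI[of _ _ "(0, 0)"]) (auto simp: g_def level_spectrum_def)
    fix p x assume p: "coprime p N"
    have factor: "mask_prod (Suc n) (x + real p * of_int (l + int N ^ n * d)) =
       mask_prod n (x + real p * of_int l) * mask ((x + real p * of_int l) / real N ^ Suc n + real p * of_int d / real N)" for l d
    proof -
      have "x + real p * of_int (l + int N ^ n * d) = (x + real p * of_int l) + of_int (int N ^ n * (int p * d))"
        by (simp add: algebra_simps)
      moreover have "(x + real p * of_int (l + int N ^ n * d)) / real N ^ Suc n =
        (x + real p * of_int l) / real N ^ Suc n + real p * of_int d / real N"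
        using N_pos by (simp add: field_simps)
      ultimately show ?thesis
        unfolding mask_prod.simps by (simp only: mask_prod_add_int)
    qed
    have "(\<Sum>l\<in>g ` (\<Lambda> \<times> L). (cmod (mask_prod (Suc n) (x + real p * of_int l)))\<^sup>2) =
      (\<Sum>(l, d)\<in>\<Lambda> \<times> L. (cmod (mask_prod (Suc n) (x + real p * of_int (l + int N ^ n * d))))\<^sup>2)"
      by (subst sum.reindex[OF inj]) (simp add: g_def case_prod_unfold)
    also have "\<dots> = (\<Sum>l\<in>\<Lambda>. (cmod (mask_prod n (x + real p * of_int l)))\<^sup>2 *
        (\<Sum>d\<in>L. (cmod (mask ((x + real p * of_int l) / real N ^ Suc n + real p * of_int d / real N)))\<^sup>2))"
      unfolding factor norm_mult power_mult_distrib sum_distrib_left by (rule sum.cartesian_product[symmetric])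
    also have "\<dots> = 1"
      using \<Lambda> p by (simp only: mask_frame_L[OF p] level_spectrum_def mult_1_right)
    finally show "(\<Sum>l\<in>g ` (\<Lambda> \<times> L). (cmod (mask_prod (Suc n) (x + real p * of_int l)))\<^sup>2) = 1" .
  qed
qed

lemma level_spectrum_extend:
  assumes "level_spectrum n \<Lambda>"
  shows "\<exists>\<Lambda>'. level_spectrum (n + m) \<Lambda>' \<and> \<Lambda> \<subseteq> \<Lambda>'"
proof (induction m)
  case 0 then show ?case using assms by auto
next
  case (Suc m)
  then obtain \<Lambda>1 where "level_spectrum (n + m) \<Lambda>1" "\<Lambda> \<subseteq> \<Lambda>1" by blast
  with level_spectrum_Suc[of "n + m" \<Lambda>1] show ?case by (metis add_Suc_right order_trans)
qed

lemma level_spectrum_translate: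
  assumes \<Lambda>: "level_spectrum n \<Lambda>" and "\<kappa> 0 = 0"
  shows "level_spectrum n ((\<lambda>l. l + int N ^ n * \<kappa> l) ` \<Lambda>)"
proof -
  have inj: "inj_on (\<lambda>l. l + int N ^ n * \<kappa> l) \<Lambda>"
  proof (rule inj_onI)
    fix l l' assume *: "l \<in> \<Lambda>" "l' \<in> \<Lambda>" "l + int N ^ n * \<kappa> l = l' + int N ^ n * \<kappa> l'"
    then have "l = l' + int N ^ n * (\<kappa> l' - \<kappa> l)" by (simp add: right_diff_distrib)
    then show "l = l'" using level_spectrum_distinct_mod[OF \<Lambda>] * by blast
  qed
  show ?thesis
    unfolding level_spectrum_def
  proof (intro conjI allI impI)
    show "finite ((\<lambda>l. l + int N ^ n * \<kappa> l) ` \<Lambda>)" using \<Lambda> by (simp add: level_spectrum_def)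
    show "0 \<in> (\<lambda>l. l + int N ^ n * \<kappa> l) ` \<Lambda>"
      using \<Lambda> assms(2) by (intro image_eqI[of _ _ 0]) (auto simp: level_spectrum_def)
    fix p x assume p: "coprime p N"
    have "mask_prod n (x + real p * of_int (l + int N ^ n * \<kappa> l)) = mask_prod n (x + real p * of_int l)" for l
    proof -
      have "x + real p * of_int (l + int N ^ n * \<kappa> l) = (x + real p * of_int l) + of_int (int N ^ n * (int p * \<kappa> l))"
        by (simp add: algebra_simps)
      then show ?thesis by (simp only: mask_prod_add_int)
    qed
    then have "(\<Sum>l\<in>(\<lambda>l. l + int N ^ n * \<kappa> l) ` \<Lambda>. (cmod (mask_prod n (x + real p * of_int l)))\<^sup>2) =
      (\<Sum>l\<in>\<Lambda>. (cmod (mask_prod n (x + real p * of_int l)))\<^sup>2)"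
      by (subst sum.reindex[OF inj]) (simp only: o_def)
    then show "(\<Sum>l\<in>(\<lambda>l. l + int N ^ n * \<kappa> l) ` \<Lambda>. (cmod (mask_prod n (x + real p * of_int l)))\<^sup>2) = 1"
      using \<Lambda> p by (simp add: level_spectrum_def)
  qed
qed

text \<open>The level is raised so far that the old frequencies become small compared with \<open>N\<^bsup>n'\<^esup>\<close>; only the new
  frequencies are then translated by multiples of \<open>N\<^bsup>n'\<^esup>\<close>. Hence the old set is contained in the new one
  and the lower bound holds on the whole new set.\<close>
lemma level_spectrum_stage:
  assumes \<Lambda>: "level_spectrum n \<Lambda>" and \<delta>: "\<delta> > 0"
    and translate: "\<And>x. \<exists>k::int. \<forall>y. \<bar>y\<bar> \<le> \<delta> \<longrightarrow> \<epsilon> \<le> norm (muhat (real p * (x + of_int k) + y))"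
    and near_0: "\<And>z. \<bar>z\<bar> \<le> 2 * \<delta> \<Longrightarrow> \<epsilon> \<le> norm (muhat z)"
  shows "\<exists>n' \<Lambda>'. n < n' \<and> \<Lambda> \<subseteq> \<Lambda>' \<and> level_spectrum n' \<Lambda>' \<and>
    (\<forall>l\<in>\<Lambda>'. \<forall>y. \<bar>y\<bar> \<le> \<delta> \<longrightarrow> \<epsilon> \<le> norm (muhat (real p * of_int l / real N ^ n' + y)))"
proof -
  have "\<forall>\<^sub>F m in sequentially. \<forall>l\<in>\<Lambda>. \<bar>real p * of_int l / real N ^ m\<bar> < \<delta>"
  proof (rule eventually_ball_finite)
    show "\<forall>l\<in>\<Lambda>. \<forall>\<^sub>F m in sequentially. \<bar>real p * of_int l / real N ^ m\<bar> < \<delta>"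
      using order_tendstoD(2)[OF tendsto_rabs_zero[OF scaled_tendsto_0] \<delta>] by blast
  qed (use \<Lambda> in \<open>simp add: level_spectrum_def\<close>)
  then obtain m where m: "\<And>j. j \<ge> m \<Longrightarrow> \<forall>l\<in>\<Lambda>. \<bar>real p * of_int l / real N ^ j\<bar> < \<delta>"
    unfolding eventually_sequentially by blast
  define n' where "n' = n + Suc m"
  have small: "\<bar>real p * of_int l / real N ^ n'\<bar> < \<delta>" if "l \<in> \<Lambda>" for l
    using m[of n'] that by (simp add: n'_def)
  obtain \<Lambda>1 where \<Lambda>1: "level_spectrum n' \<Lambda>1" "\<Lambda> \<subseteq> \<Lambda>1"
    using level_spectrum_extend[OF \<Lambda>, of "Suc m"] unfolding n'_def by blast
  obtain \<kappa>0 :: "real \<Rightarrow> int" where \<kappa>0: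
    "\<And>x y. \<bar>y\<bar> \<le> \<delta> \<Longrightarrow> \<epsilon> \<le> norm (muhat (real p * (x + of_int (\<kappa>0 x)) + y))"
    using translate by metis
  define \<kappa> where "\<kappa> l = (if l \<in> \<Lambda> then 0 else \<kappa>0 (of_int l / real N ^ n'))" for l :: int
  define \<Lambda>' where "\<Lambda>' = (\<lambda>l. l + int N ^ n' * \<kappa> l) ` \<Lambda>1"
  have "\<kappa> 0 = 0" using \<Lambda> by (simp add: \<kappa>_def level_spectrum_def)
  then have "level_spectrum n' \<Lambda>'"
    unfolding \<Lambda>'_def by (rule level_spectrum_translate[OF \<Lambda>1(1)])
  moreover have "\<Lambda> \<subseteq> \<Lambda>'"
  proof
    fix l assume "l \<in> \<Lambda>"
    then show "l \<in> \<Lambda>'" unfolding \<Lambda>'_def using \<Lambda>1(2) by (intro image_eqI[of _ _ l]) (auto simp: \<kappa>_def)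
  qed
  moreover have "\<epsilon> \<le> norm (muhat (real p * of_int l' / real N ^ n' + y))"
    if l': "l' \<in> \<Lambda>'" and y: "\<bar>y\<bar> \<le> \<delta>" for l' y
  proof -
    obtain l where l: "l \<in> \<Lambda>1" "l' = l + int N ^ n' * \<kappa> l" using l' by (auto simp: \<Lambda>'_def)
    show ?thesis
    proof (cases "l \<in> \<Lambda>")
      case True
      then have "\<bar>real p * of_int l' / real N ^ n' + y\<bar> \<le> 2 * \<delta>"
        using abs_triangle_ineq[of "real p * of_int l' / real N ^ n'" y] small[OF True] y l(2) True
        by (simp add: \<kappa>_def)
      then show ?thesis by (rule near_0)
    next
      case False
      have "real p * of_int l' / real N ^ n' = real p * (of_int l / real N ^ n' + of_int (\<kappa>0 (of_int l / real N ^ n')))"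
        using l(2) False N_pos by (simp add: \<kappa>_def field_simps)
      then show ?thesis using \<kappa>0[OF y] by simp
    qed
  qed
  moreover have "n < n'" by (simp add: n'_def)
  ultimately show ?thesis by blast
qed

text \<open>Write \<open>a(l) = |\<mu>^(x + pl)|\<^sup>2\<close> and \<open>b\<^sub>k(l) = |M\<^sub>n(x + pl)|\<^sup>2\<close> for \<open>n = n\<^sub>k\<close>. Since \<open>a \<le> b\<^sub>k\<close> and \<open>b\<^sub>k\<close> sums to 1 over
  \<open>\<Lambda>\<^sub>k\<close>, the sum of \<open>a\<close> is at most 1. At good stages \<open>b\<^sub>k \<le> a/\<epsilon>\<^sup>2\<close> on \<open>\<Lambda>\<^sub>k\<close> as well, so the part of the sum
  of \<open>b\<^sub>k\<close> outside a large fixed \<open>\<Lambda>\<^sub>j\<close> is uniformly small. On \<open>\<Lambda>\<^sub>j\<close> itself \<open>b\<^sub>k\<close> converges to \<open>a\<close>, and no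
  mass is lost.\<close>
lemma parseval_union:
  assumes n: "strict_mono n" and mono: "incseq \<Lambda>" and level: "\<And>k. level_spectrum (n k) (\<Lambda> k)"
    and p: "coprime p N" and \<epsilon>: "\<epsilon> > 0" and \<delta>: "\<delta> > 0"
    and good: "\<exists>\<^sub>F k in sequentially. \<forall>l\<in>\<Lambda> k. \<forall>y. \<bar>y\<bar> \<le> \<delta> \<longrightarrow>
      \<epsilon> \<le> norm (muhat (real p * of_int l / real N ^ n k + y))"
  shows "((\<lambda>l. (cmod (muhat (x + real p * of_int l)))\<^sup>2) has_sum 1) (\<Union>k. \<Lambda> k)"
proof -
  define a where "a l = (cmod (muhat (x + real p * of_int l)))\<^sup>2" for l :: int
  define b where "b k l = (cmod (mask_prod (n k) (x + real p * of_int l)))\<^sup>2" for k and l :: int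
  define U where "U = (\<Union>k. \<Lambda> k)"
  have fin: "finite (\<Lambda> k)" for k using level by (simp add: level_spectrum_def)
  have sum_b: "sum (b k) (\<Lambda> k) = 1" for k using level[of k] p by (simp add: level_spectrum_def b_def)
  have ab: "a l = b k l * (cmod (muhat ((x + real p * of_int l) / real N ^ n k)))\<^sup>2" for k l
    unfolding a_def b_def using muhat_eq_mask_prod[of "x + real p * of_int l" "n k"]
    by (simp add: norm_mult power_mult_distrib)
  have a_le_b: "a l \<le> b k l" for k l
  proof -
    have "(cmod (muhat ((x + real p * of_int l) / real N ^ n k)))\<^sup>2 \<le> 1"
      by (intro power_le_one norm_muhat_le_1) simp
    then show ?thesis unfolding ab[of l k] by (intro mult_left_le) (simp_all add: b_def)
  qed
  have b_le_a: "b k l \<le> a l / \<epsilon>\<^sup>2" if "\<epsilon> \<le> cmod (muhat ((x + real p * of_int l) / real N ^ n k))" for k l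
  proof -
    have "\<epsilon>\<^sup>2 \<le> (cmod (muhat ((x + real p * of_int l) / real N ^ n k)))\<^sup>2"
      using that \<epsilon> by (intro power_mono) auto
    then have "b k l * \<epsilon>\<^sup>2 \<le> a l" unfolding ab[of l k] by (intro mult_left_mono) (auto simp: b_def)
    then show ?thesis using \<epsilon> by (simp add: pos_le_divide_eq)
  qed
  have a_nonneg: "a l \<ge> 0" for l by (simp add: a_def)
  have F_sub: "\<exists>k. F \<subseteq> \<Lambda> k" if "finite F" "F \<subseteq> U" for F
    using that
  proof (induction F rule: finite_induct)
    case (insert l F)
    then obtain k j where "F \<subseteq> \<Lambda> k" "l \<in> \<Lambda> j" by (auto simp: U_def)
    then have "insert l F \<subseteq> \<Lambda> (max k j)"
      using incseqD[OF mono, of k "max k j"] incseqD[OF mono, of j "max k j"] by auto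
    then show ?case ..
  qed simp
  have upper: "sum a F \<le> 1" if "finite F" "F \<subseteq> U" for F
  proof -
    obtain k where k: "F \<subseteq> \<Lambda> k" using F_sub[OF \<open>finite F\<close> \<open>F \<subseteq> U\<close>] by blast
    have "sum a F \<le> sum a (\<Lambda> k)" using k fin a_nonneg by (intro sum_mono2) auto
    also have "\<dots> \<le> sum (b k) (\<Lambda> k)" by (intro sum_mono a_le_b)
    finally show ?thesis by (simp add: sum_b)
  qed
  have "a summable_on U"
    by (rule nonneg_bdd_above_summable_on) (use upper a_nonneg in \<open>auto intro!: bdd_aboveI[of _ 1]\<close>)
  then obtain s where s: "(a has_sum s) U" by (auto simp: summable_on_def)
  have le_s: "sum a F \<le> s" if "finite F" "F \<subseteq> U" for F
    using s that a_nonneg by (intro finite_sum_le_has_sum) auto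
  have "s \<le> 1"
    using s upper by (rule has_sum_le_finite_sums)
  moreover have "1 \<le> s"
  proof (rule field_le_epsilon)
    fix e :: real assume e: "e > 0"
    define \<eta> where "\<eta> = e * \<epsilon>\<^sup>2"
    have \<eta>: "\<eta> > 0" using e \<epsilon> by (simp add: \<eta>_def)
    from s have "(sum a \<longlongrightarrow> s) (finite_subsets_at_top U)" unfolding has_sum_def .
    from order_tendstoD(1)[OF this, of "s - \<eta>"] \<eta> obtain F where F: "finite F" "F \<subseteq> U" "s - \<eta> < sum a F"
      unfolding eventually_finite_subsets_at_top by auto
    obtain k0 where k0: "F \<subseteq> \<Lambda> k0" using F_sub[OF F(1,2)] by blast
    have "sum a F \<le> sum a (\<Lambda> k0)" using k0 fin a_nonneg by (intro sum_mono2) auto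
    with F(3) have F0: "s - \<eta> < sum a (\<Lambda> k0)" by linarith
    have n_lim: "filterlim n at_top sequentially" using n by (rule filterlim_subseq)
    have lim: "(\<lambda>k. sum (b k) (\<Lambda> k0)) \<longlonglongrightarrow> sum a (\<Lambda> k0)"
      unfolding a_def b_def
      by (intro tendsto_sum tendsto_power tendsto_norm filterlim_compose[OF mask_prod_tendsto_muhat n_lim])
    have x_small: "\<forall>\<^sub>F k in sequentially. \<bar>x / real N ^ n k\<bar> < \<delta>"
      using order_tendstoD(2)[OF tendsto_rabs_zero[OF filterlim_compose[OF scaled_tendsto_0 n_lim]] \<delta>] .
    have "\<exists>\<^sub>F k in sequentially. 1 - e \<le> sum (b k) (\<Lambda> k0)"
      using frequently_eventually_frequently[OF good eventually_conj[OF x_small eventually_ge_at_top[of k0]]]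
    proof (rule frequently_elim1)
      fix k assume k: "(\<forall>l\<in>\<Lambda> k. \<forall>y. \<bar>y\<bar> \<le> \<delta> \<longrightarrow> \<epsilon> \<le> norm (muhat (real p * of_int l / real N ^ n k + y))) \<and>
        \<bar>x / real N ^ n k\<bar> < \<delta> \<and> k0 \<le> k"
      have sub: "\<Lambda> k0 \<subseteq> \<Lambda> k" using k incseqD[OF mono] by blast
      have "b k l \<le> a l / \<epsilon>\<^sup>2" if "l \<in> \<Lambda> k" for l
      proof (rule b_le_a)
        have "\<epsilon> \<le> norm (muhat (real p * of_int l / real N ^ n k + x / real N ^ n k))"
          using k that by (simp add: less_imp_le)
        then show "\<epsilon> \<le> cmod (muhat ((x + real p * of_int l) / real N ^ n k))"
          by (simp add: add_divide_distrib add.commute)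
      qed
      then have "sum (b k) (\<Lambda> k - \<Lambda> k0) \<le> (\<Sum>l\<in>\<Lambda> k - \<Lambda> k0. a l / \<epsilon>\<^sup>2)" by (intro sum_mono) auto
      also have "\<dots> = (sum a (\<Lambda> k) - sum a (\<Lambda> k0)) / \<epsilon>\<^sup>2"
        using sub fin by (simp add: sum_diff sum_divide_distrib[symmetric])
      also have "\<dots> \<le> \<eta> / \<epsilon>\<^sup>2"
      proof (intro divide_right_mono)
        have "\<Lambda> k \<subseteq> U" by (auto simp: U_def)
        then show "sum a (\<Lambda> k) - sum a (\<Lambda> k0) \<le> \<eta>" using le_s[OF fin, of k] F0 by simp
      qed simp
      also have "\<dots> = e" using \<epsilon> by (simp add: \<eta>_def)
      finally have "sum (b k) (\<Lambda> k - \<Lambda> k0) \<le> e" .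
      moreover have "sum (b k) (\<Lambda> k) = sum (b k) (\<Lambda> k - \<Lambda> k0) + sum (b k) (\<Lambda> k0)"
        using sum.subset_diff[OF sub fin] .
      ultimately show "1 - e \<le> sum (b k) (\<Lambda> k0)" using sum_b[of k] by linarith
    qed
    then have "1 - e \<le> sum a (\<Lambda> k0)"
    proof (rule contrapos_pp)
      assume "\<not> 1 - e \<le> sum a (\<Lambda> k0)"
      then have "\<forall>\<^sub>F k in sequentially. sum (b k) (\<Lambda> k0) < 1 - e"
        using order_tendstoD(2)[OF lim] by simp
      then show "\<not> (\<exists>\<^sub>F k in sequentially. 1 - e \<le> sum (b k) (\<Lambda> k0))"
        by (simp add: not_frequently not_le)
    qed
    also have "\<dots> \<le> s" by (rule le_s[OF fin]) (auto simp: U_def)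
    finally show "1 \<le> s + e" by simp
  qed
  ultimately have "s = 1" by simp
  then show ?thesis using s unfolding a_def U_def by simp
qed

lemma muhat_vanishes_on_L:
  assumes "l \<in> L" "l \<noteq> 0"
  shows "muhat (of_int l) = 0"
proof -
  have "(\<Sum>b\<in>B. e2pi (of_int (b * (l - 0)) / real N)) = 0"
    by (rule column_orthogonality) (use assms zero_in_L in auto)
  then have "mask (of_int l / real N) = 0" by (simp add: mask_def)
  then show ?thesis using muhat_self_similar[of "of_int l"] by simp
qed

lemma spectrum_dilate_if_parseval:
  assumes p: "p > 0" and parseval: "\<And>x. ((\<lambda>l. (cmod (muhat (x + real p * of_int l)))\<^sup>2) has_sum 1) \<Lambda>"
  shows "is_spectrum (self_similar_measure N B) ((\<lambda>l. real p * of_int l) ` \<Lambda>)"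
proof -
  obtain K where "AE x in self_similar_measure N B. \<bar>x\<bar> \<le> K" using self_similar_measure_bounded by blast
  then interpret bounded_distribution "self_similar_measure N B" K
    using real_distribution_self_similar_measure
    by (simp add: bounded_distribution_def bounded_distribution_axioms_def)
  show ?thesis
  proof (rule spectrum_if_parseval)
    fix x
    have "cmod (muhat (x - real p * of_int l)) = cmod (muhat (- x + real p * of_int l))" for l :: int
      using ft_uminus[of "x - real p * of_int l"] by (metis complex_mod_cnj minus_diff_eq uminus_add_conv_diff)
    then have "((\<lambda>l. (cmod (muhat (x - real p * of_int l)))\<^sup>2) has_sum 1) \<Lambda>"
      using parseval[of "- x"] by simp
    then show "((\<lambda>l. (cmod (muhat (x - l)))\<^sup>2) has_sum 1) ((\<lambda>l. real p * of_int l) ` \<Lambda>)"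
      using p by (subst has_sum_reindex) (auto simp: inj_on_def o_def)
  qed
qed

text \<open>The stages are indexed by codes of pairs \<open>(p, j)\<close>, so each multiplier \<open>p\<close> is served infinitely often.\<close>
theorem universal_spectrum:
  "\<exists>\<Lambda> :: int set. 0 \<in> \<Lambda> \<and> (\<exists>l\<in>\<Lambda>. l \<noteq> 0) \<and>
     (\<forall>p>0. coprime p N \<longrightarrow> is_spectrum (self_similar_measure N B) ((\<lambda>l. real p * of_int l) ` \<Lambda>))"
proof -
  have "\<forall>p. \<exists>\<epsilon> \<delta>. coprime p N \<and> p > 0 \<longrightarrow> \<epsilon> > 0 \<and> \<delta> > 0 \<and>
    (\<forall>x. \<exists>k::int. \<forall>y. \<bar>y\<bar> \<le> \<delta> \<longrightarrow> \<epsilon> \<le> norm (muhat (real p * (x + of_int k) + y))) \<and>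
    (\<forall>z. \<bar>z\<bar> \<le> 2 * \<delta> \<longrightarrow> \<epsilon> \<le> norm (muhat z))"
    using uniform_lower_bound by blast
  then obtain E D where ED: "\<And>p. coprime p N \<Longrightarrow> p > 0 \<Longrightarrow> E p > 0 \<and> D p > 0 \<and>
    (\<forall>x. \<exists>k::int. \<forall>y. \<bar>y\<bar> \<le> D p \<longrightarrow> E p \<le> norm (muhat (real p * (x + of_int k) + y))) \<and>
    (\<forall>z. \<bar>z\<bar> \<le> 2 * D p \<longrightarrow> E p \<le> norm (muhat z))"
    by metis
  define good where "good p n \<Lambda> \<longleftrightarrow> (\<forall>l\<in>\<Lambda>. \<forall>y. \<bar>y\<bar> \<le> D p \<longrightarrow>
    E p \<le> norm (muhat (real p * of_int l / real N ^ n + y)))" for p n and \<Lambda> :: "int set"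
  define q where "q k = fst (prod_decode k)" for k
  \<comment> \<open>At stages whose index decodes to an inadmissible multiplier the level is raised by one.\<close>
  have "\<exists>f. \<forall>k. (case f k of (n, \<Lambda>) \<Rightarrow> level_spectrum n \<Lambda>) \<and>
    (case f k of (n, \<Lambda>) \<Rightarrow> case f (Suc k) of (n', \<Lambda>') \<Rightarrow>
       n < n' \<and> \<Lambda> \<subseteq> \<Lambda>' \<and> (coprime (q k) N \<and> q k > 0 \<longrightarrow> good (q k) n' \<Lambda>'))"
  proof (rule dependent_nat_choice)
    show "\<exists>z. case z of (n, \<Lambda>) \<Rightarrow> level_spectrum n \<Lambda>"
      using level_spectrum_0 by (intro exI[of _ "(0, {0})"]) simp
    fix z :: "nat \<times> int set" and k
    assume "case z of (n, \<Lambda>) \<Rightarrow> level_spectrum n \<Lambda>"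
    then obtain n \<Lambda> where z: "z = (n, \<Lambda>)" and \<Lambda>: "level_spectrum n \<Lambda>" by (cases z) auto
    have "\<exists>n' \<Lambda>'. n < n' \<and> \<Lambda> \<subseteq> \<Lambda>' \<and> level_spectrum n' \<Lambda>' \<and>
      (coprime (q k) N \<and> q k > 0 \<longrightarrow> good (q k) n' \<Lambda>')"
    proof (cases "coprime (q k) N \<and> q k > 0")
      case True
      then show ?thesis
        using level_spectrum_stage[OF \<Lambda>, of "D (q k)" "E (q k)" "q k"] ED[of "q k"]
        unfolding good_def by blast
    next
      case False
      then show ?thesis using level_spectrum_Suc[OF \<Lambda>] by blast
    qed
    then show "\<exists>z'. (case z' of (n', \<Lambda>') \<Rightarrow> level_spectrum n' \<Lambda>') \<and>
      (case z of (n, \<Lambda>) \<Rightarrow> case z' of (n', \<Lambda>') \<Rightarrow>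
       n < n' \<and> \<Lambda> \<subseteq> \<Lambda>' \<and> (coprime (q k) N \<and> q k > 0 \<longrightarrow> good (q k) n' \<Lambda>'))"
      unfolding z by auto
  qed
  then obtain f where f: "\<And>k. (case f k of (n, \<Lambda>) \<Rightarrow> level_spectrum n \<Lambda>) \<and>
    (case f k of (n, \<Lambda>) \<Rightarrow> case f (Suc k) of (n', \<Lambda>') \<Rightarrow>
       n < n' \<and> \<Lambda> \<subseteq> \<Lambda>' \<and> (coprime (q k) N \<and> q k > 0 \<longrightarrow> good (q k) n' \<Lambda>'))"
    by blast
  define n where "n k = fst (f k)" for k
  define \<Lambda> where "\<Lambda> k = snd (f k)" for k
  have level: "level_spectrum (n k) (\<Lambda> k)" for k using f[of k] by (simp add: n_def \<Lambda>_def case_prod_unfold)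
  have n: "strict_mono n"
    unfolding strict_mono_Suc_iff using f by (simp add: n_def case_prod_unfold)
  have mono: "incseq \<Lambda>"
    by (rule incseq_SucI) (use f in \<open>simp add: \<Lambda>_def case_prod_unfold\<close>)
  have stage: "good (q k) (n (Suc k)) (\<Lambda> (Suc k))" if "coprime (q k) N" "q k > 0" for k
    using f[of k] that by (simp add: n_def \<Lambda>_def case_prod_unfold)
  define U where "U = (\<Union>k. \<Lambda> k)"
  have parseval: "((\<lambda>l. (cmod (muhat (x + real p * of_int l)))\<^sup>2) has_sum 1) U"
    if p: "coprime p N" "p > 0" for p x
    unfolding U_def
  proof (rule parseval_union[OF n mono level p(1)])
    show "E p > 0" "D p > 0" using ED[OF p] by auto
    show "\<exists>\<^sub>F k in sequentially. \<forall>l\<in>\<Lambda> k. \<forall>y. \<bar>y\<bar> \<le> D p \<longrightarrow>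
      E p \<le> norm (muhat (real p * of_int l / real N ^ n k + y))"
      unfolding frequently_sequentially
    proof
      fix j
      have "j \<le> Suc (prod_encode (p, j))" using le_prod_encode_2[of j p] by simp
      moreover have "good p (n (Suc (prod_encode (p, j)))) (\<Lambda> (Suc (prod_encode (p, j))))"
        using stage[of "prod_encode (p, j)"] p by (simp add: q_def)
      ultimately show "\<exists>k\<ge>j. \<forall>l\<in>\<Lambda> k. \<forall>y. \<bar>y\<bar> \<le> D p \<longrightarrow>
        E p \<le> norm (muhat (real p * of_int l / real N ^ n k + y))"
        unfolding good_def by blast
    qed
  qed
  have "0 \<in> U" using level[of 0] by (auto simp: U_def level_spectrum_def)
  moreover have "\<exists>l\<in>U. l \<noteq> 0"
  proof (rule ccontr)
    assume "\<not> ?thesis"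
    then have U: "U = {0}" using \<open>0 \<in> U\<close> by blast
    obtain l0 where l0: "l0 \<in> L" "l0 \<noteq> 0"
    proof -
      have "\<not> L \<subseteq> {0}" using card_mono[of "{0}" L] card_L card_B_ge_2 by auto
      then show ?thesis using that by blast
    qed
    \<comment> \<open>For \<open>U = {0}\<close> Parseval's identity would force \<open>|\<mu>^| = 1\<close> everywhere.\<close>
    have "((\<lambda>l. (cmod (muhat (of_int l0 + real 1 * of_int l)))\<^sup>2) has_sum 1) {0}"
      using parseval[of 1 "of_int l0"] U by simp
    moreover have "((\<lambda>l. (cmod (muhat (of_int l0 + real 1 * of_int l)))\<^sup>2) has_sum
      (\<Sum>l\<in>{0}. (cmod (muhat (of_int l0 + real 1 * of_int l)))\<^sup>2)) {0}"
      by (rule has_sum_finite) simp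
    ultimately have "(\<Sum>l\<in>{0::int}. (cmod (muhat (of_int l0 + real 1 * of_int l)))\<^sup>2) = 1"
      using has_sum_unique by blast
    then show False using muhat_vanishes_on_L[OF l0] by simp
  qed
  ultimately show ?thesis
    using spectrum_dilate_if_parseval parseval by (intro exI[of _ U]) blast
qed

end

section \<open>Spectral eigenvalues\<close>

lemma hadamard_system_translate:
  assumes triple: "hadamard_triple N B L" and card: "card B < N"
  obtains L' where "hadamard_system N B L'"
proof -
  have fin: "finite B" "finite L" "card B = card L" "card B \<ge> 2" "N \<ge> 2"
    using triple by (auto simp: hadamard_triple_def)
  then interpret digit_system N B by unfold_locales auto
  obtain l0 where l0: "l0 \<in> L" using fin by fastforce
  have inj: "inj_on (\<lambda>l. l - l0) L" by (simp add: inj_on_def)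
  have entry: "cnj (hadamard_entry N B b (l - l0)) * hadamard_entry N B b (l' - l0) =
    cnj (hadamard_entry N B b l) * hadamard_entry N B b l'" for b l l'
    unfolding hadamard_entry_cnj_mult by (simp add: right_diff_distrib)
  have "hadamard_triple N B ((\<lambda>l. l - l0) ` L)"
    using triple inj unfolding hadamard_triple_def
    by (simp add: card_image entry del: of_int_diff)
  then have "hadamard_system N B ((\<lambda>l. l - l0) ` L)"
    using card l0 by unfold_locales auto
  then show ?thesis by (rule that)
qed

lemma eigen_ratiosE:
  assumes "t \<in> eigen_ratios N"
  obtains u v :: nat where "t = real v / real u" "u > 0" "v > 0" "coprime u N" "coprime v N"
proof -
  obtain u v :: nat where uv: "t = real v / real u" "u \<ge> 1" "v \<ge> 1" "gcd (u * v) N = 1"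
    using assms unfolding eigen_ratios_def by auto
  from uv(4) have "coprime (u * v) N" by (simp add: coprime_iff_gcd_eq_1)
  then show ?thesis using uv by (intro that) auto
qed

text \<open>The nonzero element of least absolute value in the \<open>i\<close>-th dilate is too small for the \<open>j\<close>-th one if \<open>i < j\<close>.\<close>
lemma inj_dilations:
  fixes \<Lambda> :: "int set" and c :: real
  assumes q: "q \<ge> 2" and c: "c > 0" and l: "l \<in> \<Lambda>" "l \<noteq> 0"
  shows "inj (\<lambda>j::nat. (\<lambda>l. c * real (q ^ j) * of_int l) ` \<Lambda>)"
proof (rule linorder_injI)
  fix i j :: nat assume "i < j"
  obtain l0 where l0: "l0 \<in> \<Lambda>" "l0 \<noteq> 0" and min: "\<And>l. l \<in> \<Lambda> \<Longrightarrow> l \<noteq> 0 \<Longrightarrow> nat \<bar>l0\<bar> \<le> nat \<bar>l\<bar>"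
    using ex_has_least_nat[of "\<lambda>l. l \<in> \<Lambda> \<and> l \<noteq> 0" l "\<lambda>l. nat \<bar>l\<bar>"] l by blast
  show "(\<lambda>l. c * real (q ^ i) * of_int l) ` \<Lambda> \<noteq> (\<lambda>l. c * real (q ^ j) * of_int l) ` \<Lambda>"
  proof
    assume "(\<lambda>l. c * real (q ^ i) * of_int l) ` \<Lambda> = (\<lambda>l. c * real (q ^ j) * of_int l) ` \<Lambda>"
    then obtain l1 where l1: "l1 \<in> \<Lambda>" "c * real (q ^ i) * of_int l0 = c * real (q ^ j) * of_int l1"
      using l0(1) by blast
    have "real (q ^ j) = real (q ^ i) * real (q ^ (j - i))"
      using \<open>i < j\<close> by (simp flip: power_add)
    then have "of_int l0 = real (q ^ (j - i)) * of_int l1" using l1(2) c q by simp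
    then have "of_int l0 = (of_int (int (q ^ (j - i)) * l1) :: real)" by simp
    then have eq: "l0 = int (q ^ (j - i)) * l1" by (simp only: of_int_eq_iff)
    then have "l1 \<noteq> 0" using l0 by auto
    have "q ^ 1 \<le> q ^ (j - i)" using \<open>i < j\<close> q by (intro power_increasing) auto
    then have "2 \<le> q ^ (j - i)" using q by simp
    then have "2 \<le> int (q ^ (j - i))" by linarith
    then have "2 * \<bar>l1\<bar> \<le> \<bar>l0\<bar>" unfolding eq abs_mult by (intro mult_mono) auto
    then show False using min[OF l1(1) \<open>l1 \<noteq> 0\<close>] \<open>l1 \<noteq> 0\<close> by linarith
  qed
qed

theorem corollary1p6:
  fixes N :: nat and B L :: "int set"
  assumes "hadamard_triple N B L" and "card B < N"
  shows "(\<forall>t\<in>eigen_ratios N. spectral_eigenvalue (self_similar_measure N B) t) \<and>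
    (\<forall>(k::nat) (t :: nat \<Rightarrow> real). k \<ge> 1 \<longrightarrow> (\<forall>i\<in>{1..k}. t i \<in> eigen_ratios N) \<longrightarrow>
       infinite {\<Lambda> :: real set. 0 \<in> \<Lambda> \<and> is_spectrum (self_similar_measure N B) \<Lambda> \<and>
         (\<forall>i\<in>{1..k}. is_spectrum (self_similar_measure N B) ((\<lambda>l. t i * l) ` \<Lambda>))})"
proof -
  obtain L' where "hadamard_system N B L'" using hadamard_system_translate[OF assms] .
  then interpret hadamard_system N B L' .
  obtain \<Lambda> :: "int set" and l where \<Lambda>: "0 \<in> \<Lambda>" and l: "l \<in> \<Lambda>" "l \<noteq> 0"
    and spec: "\<And>p. p > 0 \<Longrightarrow> coprime p N \<Longrightarrow>
      is_spectrum (self_similar_measure N B) ((\<lambda>l. real p * of_int l) ` \<Lambda>)"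
    using universal_spectrum by blast
  have eigen: "spectral_eigenvalue (self_similar_measure N B) t" if t: "t \<in> eigen_ratios N" for t
  proof -
    obtain u v where uv: "t = real v / real u" "u > 0" "v > 0" "coprime u N" "coprime v N"
      using t by (rule eigen_ratiosE)
    have "(\<lambda>l. t * l) ` (\<lambda>l. real u * of_int l) ` \<Lambda> = (\<lambda>l. real v * of_int l) ` \<Lambda>"
      unfolding image_image using uv by simp
    then show ?thesis
      unfolding spectral_eigenvalue_def using spec[of u] spec[of v] uv by metis
  qed
  have inf: "infinite {\<Lambda> :: real set. 0 \<in> \<Lambda> \<and> is_spectrum (self_similar_measure N B) \<Lambda> \<and>
         (\<forall>i\<in>{1..k}. is_spectrum (self_similar_measure N B) ((\<lambda>l. t i * l) ` \<Lambda>))}" (is "infinite ?X")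
    if t: "\<forall>i\<in>{1..k}. t i \<in> eigen_ratios N" for k :: nat and t :: "nat \<Rightarrow> real"
  proof -
    have "\<exists>u v :: nat. i \<in> {1..k} \<longrightarrow> t i = real v / real u \<and> u > 0 \<and> v > 0 \<and> coprime u N \<and> coprime v N" for i
      using t eigen_ratiosE by metis
    then obtain u v :: "nat \<Rightarrow> nat" where uv: "\<And>i. i \<in> {1..k} \<Longrightarrow>
      t i = real (v i) / real (u i) \<and> u i > 0 \<and> v i > 0 \<and> coprime (u i) N \<and> coprime (v i) N"
      by metis
    define U where "U = (\<Prod>i\<in>{1..k}. u i)"
    have U: "U > 0" "coprime U N"
      unfolding U_def using uv by (auto intro!: prod_pos prod_coprime_left)
    \<comment> \<open>Multiplication by powers of \<open>N + 1\<close> keeps all factors coprime to \<open>N\<close>.\<close>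
    define q where "q = N + 1"
    have q: "q \<ge> 2" "coprime q N" using N_ge_2 by (auto simp: q_def)
    define S where "S j = (\<lambda>l. real U * real (q ^ j) * of_int l) ` \<Lambda>" for j
    have "inj S" unfolding S_def using inj_dilations[OF q(1) _ l, of "real U"] U(1) by simp
    moreover have "range S \<subseteq> ?X"
    proof clarify
      fix j
      have qj: "q ^ j > 0" "coprime (q ^ j) N" using q by auto
      have "is_spectrum (self_similar_measure N B) (S j)"
        using spec[of "U * q ^ j"] U qj by (simp add: S_def)
      moreover have "0 \<in> S j" using \<Lambda> by (auto simp: S_def)
      moreover have "is_spectrum (self_similar_measure N B) ((\<lambda>l. t i * l) ` S j)" if i: "i \<in> {1..k}" for i
      proof -
        define W where "W = (\<Prod>i'\<in>{1..k} - {i}. u i')"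
        have W: "W > 0" "coprime W N"
          unfolding W_def using uv by (auto intro!: prod_pos prod_coprime_left)
        have "U = u i * W" unfolding U_def W_def using i by (intro prod.remove) auto
        then have "(\<lambda>l. t i * l) ` S j = (\<lambda>l. real (v i * W * q ^ j) * of_int l) ` \<Lambda>"
          unfolding S_def image_image using uv[OF i] by (simp add: mult.assoc)
        then show ?thesis using spec[of "v i * W * q ^ j"] uv[OF i] W qj by simp
      qed
      ultimately show "0 \<in> S j \<and> is_spectrum (self_similar_measure N B) (S j) \<and>
         (\<forall>i\<in>{1..k}. is_spectrum (self_similar_measure N B) ((\<lambda>l. t i * l) ` S j))" by blast
    qed
    ultimately show ?thesis using range_inj_infinite infinite_super by blast
  qed
  show ?thesis using eigen inf by blast
qed

end
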